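(* Let $d,r$ be integers with $2\leq r\leq\frac{d+1}{2}$, and let $[F]\in \sigma_r(V_1^d)$ be generic. For every $[L_0]\in \mathrm{Eig}(F)$ there exists $\lambda\in\mathbb{C}$ such that $\mathrm{rk}(F+\lambda L_0^d)=r+1$. In particular, if $r<\frac{d+1}{2}$, then $\mathrm{rk}(F+\lambda L_0^d)=r+1$ holds for all $\lambda\neq 0$.
   Context: Work over $\mathbb{C}$; $\mathrm{Sym}^d(\mathbb{C}^2)=\mathbb{C}[x_0,x_1]_d$ is the space of binary forms of degree $d$, and a linear form $a_0x_0+a_1x_1$ is identified with the vector $(a_0,a_1)$. The rational normal curve $V_1^d\subset\mathbb{P}(\mathrm{Sym}^d(\mathbb{C}^2))$ is the set of $[L^d]$ with $L$ a nonzero linear form; $\sigma_r(V_1^d)$ is the $r$-th secant variety, i.e. the Zariski closure of the union of the linear spans of $r$ points of $V_1^d$. The Waring rank $\mathrm{rk}(F)$ is the minimal $r$ such that $F=\sum_{i=1}^rL_i^d$ with $L_i$ linear forms. The eigenscheme $\mathrm{Eig}(F)\subset\mathbb{P}(\mathrm{Sym}^1(\mathbb{C}^2))$ is the scheme defined by the vanishing of the determinant of the $2\times 2$ matrix with rows $\nabla F(x)$ and $x$; its points are the $[L]$ with $\nabla F(L)=\lambda L$ for some $\lambda\in\mathbb{C}$ (eigenvectors of $F$). "Generic" means: for all $[F]$ in some nonempty Zariski-open subset of $\sigma_r(V_1^d)$. *)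

theory Defs
  imports "HOL-Analysis.Analysis"
begin

text \<open>
  Polynomials over the infinite field of complex numbers are identified with the polynomial
  functions they define.  The variables \<open>x\<^sub>0\<close>, \<open>x\<^sub>1\<close> are the components \<open>x $ 1\<close>, \<open>x $ 2\<close>.
\<close>

type_synonym form = "complex^2 \<Rightarrow> complex"

definition binary_form :: "nat \<Rightarrow> (nat \<Rightarrow> complex) \<Rightarrow> form" where
  "binary_form d c = (\<lambda>x. \<Sum>i\<le>d. c i * (x $ 1) ^ (d - i) * (x $ 2) ^ i)"

definition binary_forms :: "nat \<Rightarrow> form set" where
  "binary_forms d = range (binary_form d)"

definition linear_form :: "complex^2 \<Rightarrow> form" where
  "linear_form a = (\<lambda>x. a $ 1 * x $ 1 + a $ 2 * x $ 2)"

definition proj_class :: "form \<Rightarrow> form set" where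
  "proj_class F = {(\<lambda>x. k * F x) | k. k \<noteq> 0}"

definition proj_space :: "nat \<Rightarrow> form set set" where
  "proj_space d = proj_class ` (binary_forms d - {\<lambda>_. 0})"

text \<open>
  \<open>homogeneous_poly n m P\<close>: \<open>P\<close> is a homogeneous polynomial of degree \<open>m\<close> in the
  \<open>n + 1\<close> variables \<open>c 0, \<dots>, c n\<close> (the zero polynomial having every degree).
\<close>

inductive homogeneous_poly :: "nat \<Rightarrow> nat \<Rightarrow> ((nat \<Rightarrow> complex) \<Rightarrow> complex) \<Rightarrow> bool" for n where
  const: "homogeneous_poly n 0 (\<lambda>_. k)"
| coord: "i \<le> n \<Longrightarrow> homogeneous_poly n 1 (\<lambda>c. c i)"
| add: "homogeneous_poly n m P \<Longrightarrow> homogeneous_poly n m Q \<Longrightarrow> homogeneous_poly n m (\<lambda>c. P c + Q c)"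
| mult: "homogeneous_poly n m P \<Longrightarrow> homogeneous_poly n l Q \<Longrightarrow> homogeneous_poly n (m + l) (\<lambda>c. P c * Q c)"

text \<open>
  The complement of a hypersurface in the projective space of binary forms, whose homogeneous
  coordinates are the coefficients \<open>c 0, \<dots>, c d\<close>.  These sets form a basis of the Zariski topology.
\<close>

definition hypersurface_compl :: "nat \<Rightarrow> ((nat \<Rightarrow> complex) \<Rightarrow> complex) \<Rightarrow> form set set" where
  "hypersurface_compl d P =
     {proj_class (binary_form d c) | c. binary_form d c \<noteq> (\<lambda>_. 0) \<and> P c \<noteq> 0}"

definition zariski :: "nat \<Rightarrow> form set topology" where
  "zariski d = topology_generated_by {hypersurface_compl d P | P m. homogeneous_poly d m P}"

lemma topspace_zariski: "topspace (zariski d) = proj_space d"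
proof -
  have "proj_space d = hypersurface_compl d (\<lambda>_. 1)"
    by (auto simp: proj_space_def hypersurface_compl_def binary_forms_def)
  moreover have "hypersurface_compl d P \<subseteq> proj_space d" for P
    by (auto simp: proj_space_def hypersurface_compl_def binary_forms_def)
  moreover have "homogeneous_poly d 0 (\<lambda>_. 1)"
    by (rule const)
  ultimately show ?thesis
    unfolding zariski_def topology_generated_by_topspace by blast
qed

lemma homogeneous_poly_scale:
  "homogeneous_poly n m P \<Longrightarrow> P (\<lambda>i. k * c i) = k ^ m * P c"
  by (induction rule: homogeneous_poly.induct) (simp_all add: algebra_simps power_add)

definition rational_normal_curve :: "nat \<Rightarrow> form set set" where
  "rational_normal_curve d = {proj_class (\<lambda>x. linear_form a x ^ d) | a. a \<noteq> 0}"

text \<open>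
  The \<open>r\<close> points \<open>[G 0], \<dots>, [G (r - 1)]\<close> are not required to be distinct; the union of
  the spans is the same, the curve being infinite for \<open>d > 0\<close>.
\<close>

definition secant_variety :: "nat \<Rightarrow> nat \<Rightarrow> form set set" where
  "secant_variety r d = zariski d closure_of
     {proj_class (\<lambda>x. \<Sum>i<r. t i * G i x) | t G.
        (\<forall>i<r. proj_class (G i) \<in> rational_normal_curve d) \<and>
        (\<lambda>x. \<Sum>i<r. t i * G i x) \<noteq> (\<lambda>_. 0)}"

definition waring_rank :: "nat \<Rightarrow> form \<Rightarrow> nat" where
  "waring_rank d F =
     (LEAST r. \<exists>a :: nat \<Rightarrow> complex^2. F = (\<lambda>x. \<Sum>i<r. linear_form (a i) x ^ d))"

definition gradient :: "form \<Rightarrow> complex^2 \<Rightarrow> complex^2" where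
  "gradient F x = vector [deriv (\<lambda>t. F (vector [t, x $ 2])) (x $ 1),
                          deriv (\<lambda>t. F (vector [x $ 1, t])) (x $ 2)]"

text \<open>The set of (closed) points of the eigenscheme.\<close>

definition Eig :: "form \<Rightarrow> form set set" where
  "Eig F = {proj_class (linear_form a) | a.
              a \<noteq> 0 \<and> det (vector [gradient F a, a] :: complex^2^2) = 0}"

lemma eigenvector_iff:
  fixes a :: "complex^2"
  assumes "a \<noteq> 0"
  shows "det (vector [gradient F a, a] :: complex^2^2) = 0 \<longleftrightarrow> (\<exists>\<mu>. gradient F a = \<mu> *s a)"
proof
  assume "det (vector [gradient F a, a] :: complex^2^2) = 0"
  then have eq: "gradient F a $ 1 * a $ 2 = gradient F a $ 2 * a $ 1"
    by (simp add: det_2 algebra_simps)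
  have "a $ 1 \<noteq> 0 \<or> a $ 2 \<noteq> 0"
    using assms by (auto simp: vec_eq_iff forall_2)
  then show "\<exists>\<mu>. gradient F a = \<mu> *s a"
  proof
    assume "a $ 1 \<noteq> 0"
    with eq have "gradient F a = (gradient F a $ 1 / a $ 1) *s a"
      by (simp add: vec_eq_iff forall_2 field_simps)
    then show ?thesis by blast
  next
    assume "a $ 2 \<noteq> 0"
    with eq have "gradient F a = (gradient F a $ 2 / a $ 2) *s a"
      by (simp add: vec_eq_iff forall_2 field_simps)
    then show ?thesis by blast
  qed
next
  assume "\<exists>\<mu>. gradient F a = \<mu> *s a"
  then obtain \<mu> where "gradient F a = \<mu> *s a" by blast
  then show "det (vector [gradient F a, a] :: complex^2^2) = 0"
    by (simp add: det_2)
qed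

end

theory Submission
  imports Defs "HOL-Computational_Algebra.Fundamental_Theorem_Algebra" "Jordan_Normal_Form.Determinant"
begin

text \<open>
  Write a form as \<open>F = (\<Sum>k\<le>d. (d choose k) * f k * x\<^sub>0^(d - k) * x\<^sub>1^k)\<close> and let its moments \<open>f\<close> act on
  polynomials by \<open>x^k \<mapsto> f k\<close>.  The form is \<open>\<Sum>i<r. c i * (x\<^sub>0 + a i * x\<^sub>1)^d\<close> if and only if this
  functional is \<open>p \<mapsto> \<Sum>i<r. c i * p (a i)\<close> on polynomials of degree at most \<open>d\<close>.

  Two facts carry the proof.  The first one concerns a fixed sum \<open>F\<close> of \<open>r\<close> powers of pairwise
  independent linear forms and a linear form \<open>L\<close> independent of each of them
  (\<open>waring_rank_add_power\<close>).  In coordinates in which \<open>L\<close> is the point at infinity, \<open>F + \<mu> L^d\<close> has the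
  functional \<open>p \<mapsto> (\<Sum>i<r. c i * p (a i)) + \<mu> * coeff p d\<close>.  A decomposition into at most \<open>r\<close> powers is
  tested on \<open>e = \<Prod>t\<in>T. (x - t)\<close>, with \<open>T\<close> its set of finite points, times Lagrange polynomials at the
  nodes.  For \<open>2 r \<le> d\<close> this forces \<open>T\<close> to be the set of nodes and \<open>\<mu> = 0\<close>.  For \<open>d = 2 r - 1\<close> it forces
  \<open>e = g - \<mu> u\<close> with \<open>g\<close> and \<open>u\<close> depending on \<open>F\<close> and \<open>L\<close> only.  By a ramification count
  (\<open>pencil_double_root\<close>) some member \<open>g - \<mu> u\<close> has a double root, whereas \<open>e\<close> has none; for this \<open>\<mu>\<close>
  the rank exceeds \<open>r\<close>.

  The second fact is that a generic point of the secant variety is such a sum and that none of its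
  summands is an eigenvector (\<open>generic_decomposition\<close>, \<open>summand_not_eigenvector\<close>).  The minors of a
  Hankel matrix of \<open>f\<close> define the apolar polynomial, of degree at most \<open>r\<close>.  The functional kills its
  multiples if \<open>F\<close> is a sum of \<open>r\<close> powers, hence on the whole Zariski closure.  If it has degree \<open>r\<close> and
  simple roots, \<open>F\<close> is a sum of powers of the linear forms given by the roots
  (\<open>apolar_representation\<close>).  Full degree, simplicity of the roots, and the absence of common roots with
  the polynomial whose roots are the eigenvectors \<open>(1, x)\<close> amount to the nonvanishing of one homogeneous polynomial
  in the coefficients of \<open>F\<close>, a leading coefficient times a resultant.  It remains to see that this
  polynomial does not vanish identically on the secant variety, for which forms with the nodes
  \<open>0, \<dots>, r - 1\<close> and weights \<open>K^i\<close> suffice (\<open>generic_weights\<close>).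
\<close>

hide_const (open) Module.smult

section \<open>Homogeneous polynomials and determinants\<close>

lemma homogeneous_poly_cong:
  "homogeneous_poly n m P \<Longrightarrow> (\<And>i. i \<le> n \<Longrightarrow> c i = c' i) \<Longrightarrow> P c = P c'"
  by (induction rule: homogeneous_poly.induct) auto

lemma homogeneous_poly_cmult:
  assumes "homogeneous_poly n m P"
  shows "homogeneous_poly n m (\<lambda>c. k * P c)"
  using homogeneous_poly.mult[OF homogeneous_poly.const assms, of k] by simp

text \<open>
  The zero polynomial is homogeneous of every degree, which the inductive definition gives only
  through a multiple of some monomial of that degree.
\<close>

lemma homogeneous_poly_zero: "homogeneous_poly n m (\<lambda>_. 0)"
proof -
  have "homogeneous_poly n m (\<lambda>c. c 0 ^ m)"
  proof (induction m)
    case (Suc m)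
    from homogeneous_poly.mult[OF homogeneous_poly.coord[of 0 n] this] show ?case by simp
  qed (use homogeneous_poly.const[of n 1] in simp)
  from homogeneous_poly_cmult[OF this, of 0] show ?thesis by simp
qed

lemma homogeneous_poly_sum:
  assumes "\<And>i. i \<in> A \<Longrightarrow> homogeneous_poly n m (P i)"
  shows "homogeneous_poly n m (\<lambda>c. \<Sum>i\<in>A. P i c)"
  using assms
proof (induction A rule: infinite_finite_induct)
  case (insert i A)
  have "homogeneous_poly n m (\<lambda>c. P i c + (\<Sum>i\<in>A. P i c))"
    using insert by (intro homogeneous_poly.add) blast+
  then show ?case using insert by simp
qed (simp_all add: homogeneous_poly_zero)

lemma homogeneous_poly_prod:
  assumes "finite A" "\<And>i. i \<in> A \<Longrightarrow> homogeneous_poly n (\<delta> i) (P i)"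
  shows "homogeneous_poly n (\<Sum>i\<in>A. \<delta> i) (\<lambda>c. \<Prod>i\<in>A. P i c)"
  using assms
proof (induction A rule: finite_induct)
  case (insert i A)
  have "homogeneous_poly n (\<delta> i + (\<Sum>i\<in>A. \<delta> i)) (\<lambda>c. P i c * (\<Prod>i\<in>A. P i c))"
    using insert by (intro homogeneous_poly.mult) blast+
  then show ?case using insert by simp
qed (simp add: homogeneous_poly.const)

text \<open>
  Every term of the Leibniz formula takes exactly one entry from each row, so the row degrees add up
  even when they differ from row to row.
\<close>

lemma homogeneous_poly_det:
  assumes "\<And>i j. i < N \<Longrightarrow> j < N \<Longrightarrow> homogeneous_poly n (\<delta> i) (A i j)"
  shows "homogeneous_poly n (\<Sum>i<N. \<delta> i) (\<lambda>c. Determinant.det (mat N N (\<lambda>(i, j). A i j c)))"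
proof -
  have eq: "Determinant.det (mat N N (\<lambda>(i, j). A i j c)) =
      (\<Sum>p\<in>{p. p permutes {0..<N}}. of_int (sign p) * (\<Prod>i\<in>{..<N}. A i (p i) c))" for c
  proof -
    have prod_eq: "(\<Prod>i = 0..<N. mat N N (\<lambda>(i, j). A i j c) $$ (i, p i)) = (\<Prod>i\<in>{..<N}. A i (p i) c)"
      if p: "p permutes {0..<N}" for p
    proof (rule prod.cong)
      fix i assume "i \<in> {..<N}"
      then have "i < N" "p i < N" using permutes_in_image[OF p, of i] by auto
      then show "mat N N (\<lambda>(i, j). A i j c) $$ (i, p i) = A i (p i) c" by simp
    qed auto
    have "Determinant.det (mat N N (\<lambda>(i, j). A i j c)) = (\<Sum>p\<in>{p. p permutes {0..<N}}.
        of_int (sign p) * (\<Prod>i = 0..<N. mat N N (\<lambda>(i, j). A i j c) $$ (i, p i)))"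
      by (rule det_def') simp
    also have "\<dots> = (\<Sum>p\<in>{p. p permutes {0..<N}}. of_int (sign p) * (\<Prod>i\<in>{..<N}. A i (p i) c))"
      by (rule sum.cong[OF refl]) (simp only: mem_Collect_eq prod_eq)
    finally show ?thesis .
  qed
  show ?thesis unfolding eq
  proof (rule homogeneous_poly_sum)
    fix p assume p: "p \<in> {p. p permutes {0..<N}}"
    have "homogeneous_poly n (\<Sum>i<N. \<delta> i) (\<lambda>c. \<Prod>i\<in>{..<N}. A i (p i) c)"
    proof (rule homogeneous_poly_prod)
      fix i assume "i \<in> {..<N}"
      with p show "homogeneous_poly n (\<delta> i) (A i (p i))"
        using permutes_in_image[of p "{0..<N}" i] by (intro assms) auto
    qed auto
    then show "homogeneous_poly n (\<Sum>i<N. \<delta> i)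
        (\<lambda>c. of_int (sign p) * (\<Prod>i\<in>{..<N}. A i (p i) c))"
      by (rule homogeneous_poly_cmult)
  qed
qed

lemma det_eq_0_iff_kernel:
  fixes A :: "nat \<Rightarrow> nat \<Rightarrow> 'a :: field"
  shows "Determinant.det (mat n n (\<lambda>(i, j). A i j)) = 0 \<longleftrightarrow>
    (\<exists>v. (\<exists>j<n. v j \<noteq> 0) \<and> (\<forall>i<n. (\<Sum>j<n. A i j * v j) = 0))"
proof -
  let ?A = "mat n n (\<lambda>(i, j). A i j)"
  have eq: "?A *\<^sub>v v = 0\<^sub>v n \<longleftrightarrow> (\<forall>i<n. (\<Sum>j<n. A i j * v $ j) = 0)" if "v \<in> carrier_vec n" for v
    using that by (auto simp: vec_eq_iff scalar_prod_def lessThan_atLeast0)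
  have "Determinant.det ?A = 0 \<longleftrightarrow> (\<exists>v. v \<in> carrier_vec n \<and> v \<noteq> 0\<^sub>v n \<and> ?A *\<^sub>v v = 0\<^sub>v n)"
    by (rule det_0_iff_vec_prod_zero) simp
  also have "\<dots> \<longleftrightarrow> (\<exists>v. (\<exists>j<n. v j \<noteq> 0) \<and> (\<forall>i<n. (\<Sum>j<n. A i j * v j) = 0))"
  proof safe
    fix v assume v: "v \<in> carrier_vec n" "?A *\<^sub>v v = 0\<^sub>v n" "v \<noteq> 0\<^sub>v n"
    then have "\<exists>j<n. v $ j \<noteq> 0" by (auto simp: vec_eq_iff)
    then show "\<exists>v. (\<exists>j<n. v j \<noteq> 0) \<and> (\<forall>i<n. (\<Sum>j<n. A i j * v j) = 0)"
      using v eq by blast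
  next
    fix v :: "nat \<Rightarrow> 'a" and j
    assume v: "\<forall>i<n. (\<Sum>j<n. A i j * v j) = 0" "j < n" "v j \<noteq> 0"
    have "?A *\<^sub>v vec n v = 0\<^sub>v n" by (subst eq) (use v in auto)
    moreover have "vec n v \<noteq> 0\<^sub>v n" using v by (auto simp: vec_eq_iff)
    ultimately show "\<exists>v. v \<in> carrier_vec n \<and> v \<noteq> 0\<^sub>v n \<and> ?A *\<^sub>v v = 0\<^sub>v n"
      by (intro exI[of _ "vec n v"]) auto
  qed
  finally show ?thesis .
qed

section \<open>Moment functionals\<close>

text \<open>
  Contraction of a binary form with polynomials: after scaling away the binomial coefficients, the
  coefficients \<open>f 0, f 1, \<dots>\<close> of a form define a linear functional sending \<open>x^k\<close> to \<open>f k\<close>.  A sum of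
  powers of linear forms becomes a combination of point evaluations.
\<close>

definition pairing :: "(nat \<Rightarrow> 'a :: comm_ring_1) \<Rightarrow> 'a poly \<Rightarrow> 'a" where
  "pairing f p = (\<Sum>k\<le>degree p. coeff p k * f k)"

lemma pairing_eq: "degree p \<le> N \<Longrightarrow> pairing f p = (\<Sum>k\<le>N. coeff p k * f k)"
  unfolding pairing_def by (rule sum.mono_neutral_left) (auto simp: coeff_eq_0)

lemma pairing_0 [simp]: "pairing f 0 = 0"
  by (simp add: pairing_def)

lemma pairing_add: "pairing f (p + q) = pairing f p + pairing f q"
proof -
  define N where "N = max (degree p) (degree q)"
  have "degree (p + q) \<le> N" "degree p \<le> N" "degree q \<le> N"
    by (auto simp: N_def degree_add_le_max)
  then show ?thesis by (simp add: pairing_eq[of _ N] sum.distrib algebra_simps)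
qed

lemma pairing_smult: "pairing f (smult c p) = c * pairing f p"
  using degree_smult_le[of c p] by (simp add: pairing_eq[of _ "degree p"] sum_distrib_left mult_ac)

lemma pairing_sum: "pairing f (\<Sum>i\<in>A. p i) = (\<Sum>i\<in>A. pairing f (p i))"
  by (induction A rule: infinite_finite_induct) (auto simp: pairing_add)

lemma pairing_monom: "pairing f (monom c k) = c * f k"
proof -
  have "pairing f (monom c k) = (\<Sum>i\<le>k. coeff (monom c k) i * f i)"
    by (rule pairing_eq) (rule degree_monom_le)
  also have "\<dots> = (\<Sum>i\<le>k. if i = k then c * f k else 0)"
    by (rule sum.cong) auto
  finally show ?thesis by simp
qed

lemma pairing_monom_mult:
  assumes "degree p \<le> N"
  shows "pairing f (monom 1 m * p) = (\<Sum>j\<le>N. coeff p j * f (m + j))"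
proof -
  have "monom 1 m * p = (\<Sum>j\<le>N. monom (coeff p j) (m + j))"
    by (subst poly_as_sum_of_monoms'[OF assms, symmetric]) (simp add: sum_distrib_left mult_monom)
  then show ?thesis by (simp add: pairing_sum pairing_monom)
qed

lemma pairing_mult:
  "pairing f (q * p) = (\<Sum>m\<le>degree q. coeff q m * pairing f (monom 1 m * p))"
proof -
  have "q * p = (\<Sum>m\<le>degree q. smult (coeff q m) (monom 1 m * p))"
    by (subst poly_as_sum_of_monoms[symmetric, of q])
      (simp add: sum_distrib_right smult_monom flip: mult_smult_left)
  then show ?thesis by (simp add: pairing_sum pairing_smult)
qed

text \<open>
  A moment sequence that is a sum of geometric progressions acts by evaluation at the ratios.  The
  bound on the degree matters: only the moments up to \<open>d\<close> are controlled by the form.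
\<close>

lemma pairing_points:
  assumes "\<And>k. k \<le> d \<Longrightarrow> f k = (\<Sum>i\<in>I. c i * a i ^ k)" "degree p \<le> d"
  shows "pairing f p = (\<Sum>i\<in>I. c i * poly p (a i))"
proof -
  have "pairing f p = (\<Sum>k\<le>degree p. \<Sum>i\<in>I. c i * (coeff p k * a i ^ k))"
    unfolding pairing_def using assms by (intro sum.cong) (auto simp: sum_distrib_left mult_ac)
  also have "\<dots> = (\<Sum>i\<in>I. c i * poly p (a i))"
    by (subst sum.swap) (simp add: poly_altdef sum_distrib_left)
  finally show ?thesis .
qed

text \<open>
  The Lagrange polynomials are left without normalisation, so that they are monic.
\<close>

definition lagrange_basis :: "nat \<Rightarrow> (nat \<Rightarrow> 'a :: idom) \<Rightarrow> nat \<Rightarrow> 'a poly" where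
  "lagrange_basis r a i = (\<Prod>k\<in>{..<r} - {i}. [:- a k, 1:])"

lemma poly_lagrange_basis_eq_0: "j < r \<Longrightarrow> j \<noteq> i \<Longrightarrow> poly (lagrange_basis r a i) (a j) = 0"
  by (auto simp: lagrange_basis_def poly_prod)

lemma poly_lagrange_basis_nonzero:
  "inj_on a {..<r} \<Longrightarrow> i < r \<Longrightarrow> poly (lagrange_basis r a i) (a i) \<noteq> 0"
  by (auto simp: lagrange_basis_def poly_prod inj_on_def)

lemma degree_lagrange_basis: "i < r \<Longrightarrow> degree (lagrange_basis r a i) = r - 1"
  unfolding lagrange_basis_def by (subst degree_prod_eq_sum_degree) auto

lemma lead_coeff_lagrange_basis: "lead_coeff (lagrange_basis r a i) = 1"
  unfolding lagrange_basis_def by (simp add: lead_coeff_prod)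

lemma sum_lagrange_basis:
  "i < r \<Longrightarrow> (\<Sum>j<r. c j * poly (lagrange_basis r a i) (a j)) = c i * poly (lagrange_basis r a i) (a i)"
  by (subst sum.remove[of _ i]) (auto intro!: sum.neutral simp: poly_lagrange_basis_eq_0)

section \<open>The apolar polynomial\<close>

text \<open>
  The Hankel matrix with rows \<open>(f i, \<dots>, f (i + r))\<close> for \<open>i < r\<close>, bordered from below by an arbitrary
  row \<open>w\<close>.  Its determinant is linear in \<open>w\<close>; the coefficients of this linear form are the
  coefficients of the apolar polynomial, which is thus the determinant bordered by
  \<open>(1, x, \<dots>, x^r)\<close>.
\<close>

definition hankel_bordered :: "nat \<Rightarrow> (nat \<Rightarrow> 'a) \<Rightarrow> (nat \<Rightarrow> 'a) \<Rightarrow> 'a mat" where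
  "hankel_bordered r f w = mat (Suc r) (Suc r) (\<lambda>(i, j). if i < r then f (i + j) else w j)"

definition apolar_coeff :: "nat \<Rightarrow> (nat \<Rightarrow> 'a :: comm_ring_1) \<Rightarrow> nat \<Rightarrow> 'a" where
  "apolar_coeff r f j =
     (-1) ^ (r + j) * Determinant.det (mat r r (\<lambda>(i, k). f (i + (if k < j then k else Suc k))))"

definition apolar_poly :: "nat \<Rightarrow> (nat \<Rightarrow> 'a :: comm_ring_1) \<Rightarrow> 'a poly" where
  "apolar_poly r f = (\<Sum>j\<le>r. monom (apolar_coeff r f j) j)"

lemma coeff_apolar_poly: "coeff (apolar_poly r f) j = (if j \<le> r then apolar_coeff r f j else 0)"
  by (auto simp: apolar_poly_def coeff_sum)

lemma degree_apolar_poly_le: "degree (apolar_poly r f) \<le> r"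
  by (rule degree_le) (simp add: coeff_apolar_poly)

lemma det_hankel_bordered:
  "Determinant.det (hankel_bordered r f w) = (\<Sum>j\<le>r. coeff (apolar_poly r f) j * w j)"
proof -
  have "cofactor (hankel_bordered r f w) r j = apolar_coeff r f j" if "j \<le> r" for j
    unfolding cofactor_def apolar_coeff_def mat_delete_def hankel_bordered_def using that
    by (intro arg_cong2[of _ _ _ _ "(*)"] refl arg_cong[of _ _ Determinant.det] eq_matI) auto
  then show ?thesis
    by (subst laplace_expansion_row[of _ "Suc r" r])
      (auto simp: hankel_bordered_def coeff_apolar_poly lessThan_Suc_atMost mult.commute intro!: sum.cong)
qed

lemma pairing_apolar_poly:
  "pairing f (monom 1 m * apolar_poly r f) = Determinant.det (hankel_bordered r f (\<lambda>j. f (m + j)))"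
  by (simp add: det_hankel_bordered pairing_monom_mult[OF degree_apolar_poly_le])

text \<open>
  Bordering by the \<open>m\<close>-th row, which is already there, makes the determinant vanish.
\<close>

lemma pairing_apolar_poly_eq_0: 
  assumes "m < r"
  shows "pairing f (monom 1 m * apolar_poly r f) = 0"
  unfolding pairing_apolar_poly
  by (rule det_identical_rows[of _ "Suc r" m r])
    (use assms in \<open>auto simp: hankel_bordered_def intro!: eq_vecI\<close>)

text \<open>
  The leading coefficient is the determinant of the square Hankel matrix of \<open>f\<close>, and a kernel vector
  of this matrix is a polynomial of degree below \<open>r\<close> that is apolar to \<open>f\<close>.
\<close>

lemma coeff_apolar_poly_eq_0_iff:
  fixes f :: "nat \<Rightarrow> 'a :: field"
  shows "coeff (apolar_poly r f) r = 0 \<longleftrightarrow>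
    (\<exists>q. q \<noteq> 0 \<and> degree q < r \<and> (\<forall>m<r. pairing f (monom 1 m * q) = 0))"
proof -
  have "coeff (apolar_poly r f) r = (- 1) ^ (r + r) * Determinant.det (mat r r (\<lambda>(i, k). f (i + k)))"
    unfolding coeff_apolar_poly apolar_coeff_def
    by (auto intro!: arg_cong[of _ _ Determinant.det] eq_matI)
  also have "\<dots> = 0 \<longleftrightarrow> (\<exists>v. (\<exists>j<r. v j \<noteq> 0) \<and> (\<forall>i<r. (\<Sum>j<r. f (i + j) * v j) = 0))"
    by (simp add: det_eq_0_iff_kernel)
  also have "\<dots> \<longleftrightarrow> (\<exists>q. q \<noteq> 0 \<and> degree q < r \<and> (\<forall>m<r. pairing f (monom 1 m * q) = 0))"
  proof safe
    fix v j assume v: "\<forall>i<r. (\<Sum>j<r. f (i + j) * v j) = 0" "j < r" "v j \<noteq> 0"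
    define q where "q = (\<Sum>j<r. monom (v j) j)"
    have c: "coeff q i = (if i < r then v i else 0)" for i
      by (auto simp: q_def coeff_sum)
    have "degree q \<le> r - 1" by (rule degree_le) (auto simp: c)
    have "pairing f (monom 1 m * q) = 0" if "m < r" for m
    proof -
      have "{..r - 1} = {..<r}" using v(2) by auto
      then show ?thesis
        using v(1) that by (subst pairing_monom_mult[OF \<open>degree q \<le> r - 1\<close>]) (auto simp: c mult.commute)
    qed
    then show "\<exists>q. q \<noteq> 0 \<and> degree q < r \<and> (\<forall>m<r. pairing f (monom 1 m * q) = 0)"
      using v c[of j] \<open>degree q \<le> r - 1\<close> by (intro exI[of _ q]) auto
  next
    fix q :: "'a poly" 
    assume q: "q \<noteq> 0" "degree q < r" "\<forall>m<r. pairing f (monom 1 m * q) = 0"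
    have "{..r - 1} = {..<r}" using q(2) by auto
    then have "(\<Sum>j<r. f (i + j) * coeff q j) = 0" if "i < r" for i
    proof -
      have "pairing f (monom 1 i * q) = (\<Sum>j<r. coeff q j * f (i + j))"
        using q(2) unfolding \<open>{..r - 1} = {..<r}\<close>[symmetric] by (intro pairing_monom_mult) auto
      then show ?thesis using q(3) that by (simp add: mult.commute)
    qed
    moreover have "coeff q (degree q) \<noteq> 0" using q by simp
    ultimately show "\<exists>v. (\<exists>j<r. v j \<noteq> 0) \<and> (\<forall>i<r. (\<Sum>j<r. f (i + j) * v j) = 0)"
      using q(2) by (intro exI[of _ "coeff q"]) auto
  qed
  finally show ?thesis .
qed

text \<open>
  For a sum of \<open>r\<close> powers the bordered Hankel matrix of size \<open>r + 1\<close> is a sum of \<open>r\<close> matrices of rank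
  one, so its determinant is zero.  The summands are arbitrary linear forms \<open>\<alpha> x\<^sub>0 + \<beta> x\<^sub>1\<close>, including
  those with \<open>\<alpha> = 0\<close>.
\<close>

lemma pairing_apolar_power_sum:
  fixes f :: "nat \<Rightarrow> 'a :: field"
  assumes f: "\<And>k. k \<le> d \<Longrightarrow> f k = (\<Sum>i<r. t i * \<alpha> i ^ (d - k) * \<beta> i ^ k)"
    and m: "m + r \<le> d" and d: "2 * r \<le> Suc d"
  shows "pairing f (monom 1 m * apolar_poly r f) = 0"
proof -
  \<comment> \<open>the bordering row is the row of index \<open>m\<close>, which may lie beyond the first \<open>r\<close> rows\<close>
  define \<rho> where "\<rho> s = (if s < r then s else m)" for s
  have \<rho>: "\<rho> s + r \<le> d" if "s \<le> r" for s using that m d by (auto simp: \<rho>_def)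
  \<comment> \<open>a product of an \<open>(r + 1) \<times> r\<close> and an \<open>r \<times> (r + 1)\<close> matrix, padded by a zero column of \<open>B\<close>\<close>
  define B where "B = mat (Suc r) (Suc r) (\<lambda>(s, i). if i < r then t i * \<alpha> i ^ (d - r - \<rho> s) * \<beta> i ^ \<rho> s else 0)"
  define C where "C = mat (Suc r) (Suc r) (\<lambda>(i, j). \<alpha> i ^ (r - j) * \<beta> i ^ j)"
  have entry: "(\<Sum>i<r. t i * \<alpha> i ^ (d - r - \<rho> s) * \<beta> i ^ \<rho> s * (\<alpha> i ^ (r - j) * \<beta> i ^ j)) = f (\<rho> s + j)"
    if "s \<le> r" "j \<le> r" for s j
  proof -
    have "d - r - \<rho> s + (r - j) = d - (\<rho> s + j)" using \<rho>[OF that(1)] that by linarith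
    then have "\<alpha> i ^ (d - (\<rho> s + j)) = \<alpha> i ^ (d - r - \<rho> s) * \<alpha> i ^ (r - j)" for i
      by (metis power_add)
    then show ?thesis using \<rho>[OF that(1)] that by (subst f) (auto simp: power_add mult_ac)
  qed
  have "hankel_bordered r f (\<lambda>j. f (m + j)) = B * C"
  proof (rule eq_matI)
    fix s j assume "s < dim_row (B * C)" "j < dim_col (B * C)"
    then have sj: "s \<le> r" "j \<le> r" by (auto simp: B_def C_def)
    then have "(B * C) $$ (s, j) = (\<Sum>i<r. t i * \<alpha> i ^ (d - r - \<rho> s) * \<beta> i ^ \<rho> s * (\<alpha> i ^ (r - j) * \<beta> i ^ j))"
      by (simp add: B_def C_def scalar_prod_def lessThan_atLeast0)
    also have "\<dots> = f (\<rho> s + j)" by (rule entry[OF sj])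
    also have "\<dots> = hankel_bordered r f (\<lambda>j. f (m + j)) $$ (s, j)"
      using sj by (auto simp: hankel_bordered_def \<rho>_def)
    finally show "hankel_bordered r f (\<lambda>j. f (m + j)) $$ (s, j) = (B * C) $$ (s, j)" by simp
  qed (auto simp: hankel_bordered_def B_def C_def)
  then have "pairing f (monom 1 m * apolar_poly r f) = Determinant.det B * Determinant.det C"
    unfolding pairing_apolar_poly using det_mult[of B "Suc r" C] by (auto simp: B_def C_def)
  moreover have "Determinant.det B = 0"
    unfolding B_def det_eq_0_iff_kernel
    by (rule exI[of _ "\<lambda>j. if j = r then 1 else 0"]) (auto intro!: sum.neutral)
  ultimately show ?thesis by simp
qed

lemma rsquarefree_obtain_roots:
  fixes g :: "complex poly"
  assumes "rsquarefree g"
  obtains a where "inj_on a {..<degree g}" "\<And>z. poly g z = 0 \<longleftrightarrow> z \<in> a ` {..<degree g}"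
proof -
  let ?Z = "{z. poly g z = 0}"
  have "g \<noteq> 0" using assms by (auto simp: rsquarefree_def)
  then have fin: "finite ?Z" by (rule poly_roots_finite)
  have "degree g = degree (smult (lead_coeff g) (\<Prod>z\<in>?Z. [:- z, 1:]))"
    using complex_poly_decompose_rsquarefree[OF assms] by simp
  also have "\<dots> = card ?Z"
    using \<open>g \<noteq> 0\<close> by (subst degree_smult_eq) (simp add: degree_prod_eq_sum_degree)
  finally have "card ?Z = degree g" by simp
  with ex_bij_betw_nat_finite[OF fin] obtain a where a: "bij_betw a {..<degree g} ?Z"
    by (auto simp: lessThan_atLeast0)
  then have "inj_on a {..<degree g}" "a ` {..<degree g} = ?Z" by (auto simp: bij_betw_def)
  then show thesis by (intro that[of a]) auto
qed

text \<open>
  Sylvester's criterion.  The relations say that the functional kills the multiples of the apolar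
  polynomial \<open>g\<close> up to degree \<open>d\<close>, so it factors through the remainder modulo \<open>g\<close>.  If the roots of
  \<open>g\<close> are simple, the remainder is found by Lagrange interpolation at the roots, which exhibits the
  functional as a combination of evaluations.  A vanishing weight would make the Lagrange polynomial
  at the other roots apolar, against the nonvanishing leading coefficient of \<open>g\<close>.
\<close>

lemma apolar_representation:
  fixes f :: "nat \<Rightarrow> complex" and r d :: nat
  defines "g \<equiv> apolar_poly r f"
  assumes d: "2 * r \<le> Suc d" and lc: "coeff g r \<noteq> 0"
    and rel: "\<And>m. m + r \<le> d \<Longrightarrow> pairing f (monom 1 m * g) = 0"
    and sqf: "rsquarefree g"
  obtains c a where "inj_on a {..<r}" "\<And>k. k \<le> d \<Longrightarrow> f k = (\<Sum>i<r. c i * a i ^ k)"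
    "\<And>i. i < r \<Longrightarrow> c i \<noteq> 0" "\<And>i. i < r \<Longrightarrow> poly g (a i) = 0"
proof -
  have deg: "degree g = r"
    using le_degree[OF lc] degree_apolar_poly_le[of r f] by (simp add: g_def)
  have g0: "g \<noteq> 0" using lc by auto
  obtain a where a: "inj_on a {..<r}" "\<And>z. poly g z = 0 \<longleftrightarrow> z \<in> a ` {..<r}"
    using rsquarefree_obtain_roots[OF sqf] unfolding deg by blast
  define l where "l = lagrange_basis r a"
  define c where "c i = pairing f (l i) / poly (l i) (a i)" for i
  have l_nz: "poly (l i) (a i) \<noteq> 0" if "i < r" for i
    unfolding l_def using poly_lagrange_basis_nonzero[OF a(1) that] .
  have rep: "f k = (\<Sum>i<r. c i * a i ^ k)" if k: "k \<le> d" for k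
  proof -
    define p where "p = (monom 1 k :: complex poly)"
    define s where "s = (\<Sum>i<r. smult (a i ^ k / poly (l i) (a i)) (l i))"
    have p_eq: "p = (p div g) * g + p mod g" by simp
    \<comment> \<open>reduction modulo \<open>g\<close> is interpolation at its roots\<close>
    have "p mod g = s"
    proof (cases "r = 0")
      case True
      then have "is_unit g" using deg g0 by (simp add: is_unit_iff_degree)
      then have "p mod g = 0" by (simp add: mod_eq_0_iff_dvd unit_imp_dvd)
      with True show ?thesis by (simp add: s_def)
    next
      case False
      show ?thesis
      proof (rule poly_eqI_degree[of "a ` {..<r}"])
        fix x assume "x \<in> a ` {..<r}"
        then obtain j where j: "j < r" "x = a j" by auto
        have "poly (p mod g) x = poly p x"
          using a(2)[of x] \<open>x \<in> a ` {..<r}\<close> p_eq by (metis add_0 mult_zero_right poly_add poly_mult)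
        also have "\<dots> = a j ^ k" using j by (simp add: p_def poly_monom)
        also have "\<dots> = (\<Sum>i<r. a i ^ k / poly (l i) (a i) * poly (l i) (a j))"
          using j l_nz[of j]
          by (subst sum.remove[of _ j]) (auto intro!: sum.neutral simp: l_def poly_lagrange_basis_eq_0)
        also have "\<dots> = poly s x" using j by (simp add: s_def poly_sum)
        finally show "poly (p mod g) x = poly s x" .
      next
        have "card (a ` {..<r}) = r" using a(1) by (simp add: card_image)
        moreover have "degree (p mod g) < r"
          using degree_mod_less[OF g0, of p] deg False by auto
        moreover have "degree s \<le> r - 1"
          unfolding s_def
          by (intro degree_sum_le order.trans[OF degree_smult_le]) (auto simp: l_def degree_lagrange_basis)
        ultimately show "degree (p mod g) < card (a ` {..<r})" "degree s < card (a ` {..<r})"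
          using False by auto
      qed
    qed
    have "pairing f ((p div g) * g) = 0"
    proof (cases "p div g = 0")
      case False
      have "degree (p div g) + r = degree ((p div g) * g)"
        using False g0 deg by (simp add: degree_mult_eq)
      also have "(p div g) * g = p - p mod g" by (simp add: minus_mod_eq_div_mult)
      also have "degree \<dots> \<le> d"
      proof (rule degree_diff_le)
        show "degree p \<le> d" using k degree_monom_le[of "1::complex" k] by (simp add: p_def)
        show "degree (p mod g) \<le> d"
          using degree_mod_less[OF g0, of p] deg d by auto
      qed
      finally have "pairing f (monom 1 m * g) = 0" if "m \<le> degree (p div g)" for m
        using that by (intro rel) auto
      then show ?thesis by (subst pairing_mult) (auto intro!: sum.neutral)
    qed simp
    then have "pairing f p = pairing f s"
      using p_eq \<open>p mod g = s\<close> pairing_add[of f "(p div g) * g" s] by simp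
    also have "\<dots> = (\<Sum>i<r. c i * a i ^ k)"
      by (simp add: s_def pairing_sum pairing_smult c_def mult.commute)
    finally show ?thesis by (simp add: p_def pairing_monom)
  qed
  have "c i \<noteq> 0" if i: "i < r" for i
  proof
    assume "c i = 0"
    have "pairing f (monom 1 m * l i) = 0" if "m < r" for m
    proof -
      have "degree (monom 1 m * l i) \<le> m + (r - 1)"
        by (intro order.trans[OF degree_mult_le] add_mono degree_monom_le)
          (simp add: l_def degree_lagrange_basis[OF i])
      also have "\<dots> \<le> d" using that d by auto
      finally have "pairing f (monom 1 m * l i) = (\<Sum>j<r. c j * poly (monom 1 m * l i) (a j))"
        using rep by (intro pairing_points[of d]) auto
      also have "\<dots> = (\<Sum>j<r. (c j * a j ^ m) * poly (l i) (a j))"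
        by (simp add: poly_monom mult_ac)
      also have "\<dots> = (c i * a i ^ m) * poly (l i) (a i)"
        unfolding l_def by (rule sum_lagrange_basis[OF i])
      finally show ?thesis using \<open>c i = 0\<close> by simp
    qed
    moreover have "l i \<noteq> 0" using l_nz[OF i] by auto
    moreover have "degree (l i) < r" using i by (simp add: l_def degree_lagrange_basis)
    ultimately have "coeff g r = 0"
      unfolding g_def coeff_apolar_poly_eq_0_iff by blast
    with lc show False by simp
  qed
  with rep a show thesis by (intro that[of a c]) auto
qed

text \<open>
  Conversely, for a functional with \<open>r\<close> distinct nodes and nonzero weights, pairing with multiples of
  the Lagrange polynomials isolates the values at the single nodes; hence the roots of the apolar
  polynomial are exactly the nodes.
\<close>

lemma apolar_poly_of_points:
  fixes f :: "nat \<Rightarrow> complex"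
  assumes d: "2 * r \<le> Suc d" and inj: "inj_on a {..<r}"
    and f: "\<And>k. k \<le> d \<Longrightarrow> f k = (\<Sum>i<r. c i * a i ^ k)" and c: "\<And>i. i < r \<Longrightarrow> c i \<noteq> 0"
  shows "coeff (apolar_poly r f) r \<noteq> 0"
    and "poly (apolar_poly r f) z = 0 \<longleftrightarrow> z \<in> a ` {..<r}"
    and "rsquarefree (apolar_poly r f)"
proof -
  define g where "g = apolar_poly r f"
  have separate: "poly q (a i) = 0"
    if q: "degree q \<le> r" "\<And>m. m < r \<Longrightarrow> pairing f (monom 1 m * q) = 0" and i: "i < r" for q i
  proof -
    let ?l = "lagrange_basis r a i"
    have "degree (?l * q) \<le> (r - 1) + r"
      using q(1) by (intro order.trans[OF degree_mult_le] add_mono) (auto simp: degree_lagrange_basis i)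
    also have "\<dots> \<le> d" using d i by auto
    finally have "pairing f (?l * q) = (\<Sum>j<r. c j * poly (?l * q) (a j))"
      using f by (intro pairing_points[of d]) auto
    also have "\<dots> = (\<Sum>j<r. (c j * poly q (a j)) * poly ?l (a j))"
      by (simp add: mult_ac)
    also have "\<dots> = (c i * poly q (a i)) * poly ?l (a i)"
      by (rule sum_lagrange_basis[OF i])
    also have "pairing f (?l * q) = 0"
      using q(2) i by (subst pairing_mult) (auto intro!: sum.neutral simp: degree_lagrange_basis)
    finally show ?thesis using c[OF i] poly_lagrange_basis_nonzero[OF inj i] by auto
  qed
  have card: "card (a ` {..<r}) = r" using inj by (simp add: card_image)
  have lc: "coeff g r \<noteq> 0"
  proof
    assume "coeff g r = 0"
    then obtain q where q: "q \<noteq> 0" "degree q < r" "\<And>m. m < r \<Longrightarrow> pairing f (monom 1 m * q) = 0"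
      unfolding g_def coeff_apolar_poly_eq_0_iff by blast
    have "q = 0"
      by (rule poly_eqI_degree[of "a ` {..<r}"]) (use q separate[of q] card in auto)
    with q show False by simp
  qed
  then have deg: "degree g = r" and g0: "g \<noteq> 0"
    using le_degree[OF lc] degree_apolar_poly_le[of r f] by (auto simp: g_def)
  have sub: "a ` {..<r} \<subseteq> {z. poly g z = 0}"
    using separate[of g] degree_apolar_poly_le[of r f] pairing_apolar_poly_eq_0[of _ r f]
    by (auto simp: g_def)
  have fin: "finite {z. poly g z = 0}" using g0 by (rule poly_roots_finite)
  moreover have "card {z. poly g z = 0} \<le> r"
    using card_poly_roots_bound[OF g0] deg by simp
  ultimately have eq: "a ` {..<r} = {z. poly g z = 0}"
    using sub card by (intro card_seteq) auto
  have "poly (pderiv g) z \<noteq> 0" if z: "poly g z = 0" for z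
  proof
    assume dz: "poly (pderiv g) z = 0"
    obtain q where q: "g = [:- z, 1:] * q" using z by (metis dvdE poly_eq_0_iff_dvd)
    have "pderiv g = [:- z, 1:] * pderiv q + q"
      unfolding q pderiv_mult by (simp add: pderiv_pCons)
    then have "poly q z = 0" using dz by simp
    have "q \<noteq> 0" using q g0 by auto
    then have "r = Suc (degree q)"
      using deg unfolding q by (subst (asm) degree_mult_eq) auto
    have "q = 0"
    proof (rule poly_eqI_degree[of "a ` {..<r}"])
      fix x assume "x \<in> a ` {..<r}"
      then have "poly g x = 0" using eq by auto
      then show "poly q x = poly 0 x" using \<open>poly q z = 0\<close> by (cases "x = z") (auto simp: q)
    qed (use card \<open>r = _\<close> in auto)
    with \<open>q \<noteq> 0\<close> show False by simp
  qed
  then have "rsquarefree g" unfolding rsquarefree_roots by blast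
  with lc eq show "coeff (apolar_poly r f) r \<noteq> 0"
    and "poly (apolar_poly r f) z = 0 \<longleftrightarrow> z \<in> a ` {..<r}"
    and "rsquarefree (apolar_poly r f)"
    by (auto simp: g_def)
qed

section \<open>Resultants of formal degree\<close>

text \<open>
  The degrees \<open>m\<close> and \<open>n\<close> are formal: they fix the size of the Sylvester matrix, so that its
  determinant is one polynomial expression in the coefficients even where the actual degrees drop.
\<close>

definition sylvester :: "nat \<Rightarrow> nat \<Rightarrow> 'a :: comm_ring_1 poly \<Rightarrow> 'a poly \<Rightarrow> nat \<Rightarrow> nat \<Rightarrow> 'a" where
  "sylvester m n p q i j =
     (if i < n then coeff (monom 1 i * p) j else coeff (monom 1 (i - n) * q) j)"

definition formal_resultant :: "nat \<Rightarrow> nat \<Rightarrow> 'a :: comm_ring_1 poly \<Rightarrow> 'a poly \<Rightarrow> 'a" where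
  "formal_resultant m n p q = Determinant.det (mat (n + m) (n + m) (\<lambda>(i, j). sylvester m n p q i j))"

text \<open>
  The powers of a common root form a kernel vector of the Sylvester matrix.
\<close>

lemma formal_resultant_common_root:
  fixes p q :: "'a :: field poly"
  assumes "degree p \<le> m" "degree q \<le> n" "0 < n + m" "poly p z = 0" "poly q z = 0"
  shows "formal_resultant m n p q = 0"
  unfolding formal_resultant_def det_eq_0_iff_kernel
proof (intro exI[of _ "\<lambda>j. z ^ j"] conjI allI impI)
  show "\<exists>j<n + m. z ^ j \<noteq> 0" using assms(3) by (intro exI[of _ 0]) auto
  have eval: "(\<Sum>j<n + m. coeff h j * z ^ j) = poly h z" if "degree h < n + m" for h :: "'a poly"
  proof -
    have "poly h z = (\<Sum>j\<le>degree h. coeff h j * z ^ j)" by (simp add: poly_altdef)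
    also have "\<dots> = (\<Sum>j<n + m. coeff h j * z ^ j)"
      using that by (intro sum.mono_neutral_left) (auto simp: coeff_eq_0)
    finally show ?thesis by simp
  qed
  fix i assume i: "i < n + m"
  show "(\<Sum>j<n + m. sylvester m n p q i j * z ^ j) = 0"
  proof (cases "i < n")
    case True
    have "degree (monom 1 i * p) \<le> i + m"
      using assms by (intro order.trans[OF degree_mult_le] add_mono degree_monom_le)
    then show ?thesis using True assms eval[of "monom 1 i * p"] by (simp add: sylvester_def)
  next
    case False
    have "degree (monom 1 (i - n) * q) \<le> (i - n) + n"
      using assms by (intro order.trans[OF degree_mult_le] add_mono degree_monom_le)
    then show ?thesis
      using False i assms eval[of "monom 1 (i - n) * q"] by (simp add: sylvester_def)
  qed
qed

lemma sum_lessThan_add: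
  fixes n m :: nat
  shows "(\<Sum>j<n + m. h j) = (\<Sum>j<n. h j) + (\<Sum>j<m. h (n + j))"
  by (induction m) (simp_all add: add.assoc)

text \<open>
  A vector in the kernel of the transposed matrix is a relation \<open>A p + B q = 0\<close> with
  \<open>degree B < m\<close>.  As \<open>q\<close> does not vanish at the \<open>m\<close> distinct roots of \<open>p\<close>, the factor \<open>B\<close> vanishes
  at all of them and must be zero.
\<close>

lemma formal_resultant_nonzero:
  fixes p q :: "complex poly"
  assumes p: "degree p = m" "p \<noteq> 0" "card {z. poly p z = 0} = m" and q: "degree q \<le> n"
    and no_root: "\<And>z. poly p z = 0 \<Longrightarrow> poly q z \<noteq> 0"
  shows "formal_resultant m n p q \<noteq> 0"
proof
  let ?M = "mat (n + m) (n + m) (\<lambda>(i, j). sylvester m n p q i j)"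
  assume "formal_resultant m n p q = 0"
  then have "Determinant.det (?M\<^sup>T) = 0"
    unfolding formal_resultant_def by (subst det_transpose[of _ "n + m"]) auto
  moreover have "?M\<^sup>T = mat (n + m) (n + m) (\<lambda>(i, j). sylvester m n p q j i)"
    by (rule eq_matI) auto
  ultimately have "\<exists>v. (\<exists>j<n + m. v j \<noteq> 0) \<and> (\<forall>i<n + m. (\<Sum>j<n + m. sylvester m n p q j i * v j) = 0)"
    by (simp add: det_eq_0_iff_kernel)
  then obtain v j0 where v: "j0 < n + m" "v j0 \<noteq> 0"
    "\<And>i. i < n + m \<Longrightarrow> (\<Sum>j<n + m. sylvester m n p q j i * v j) = 0" by blast
  define A where "A = (\<Sum>j<n. monom (v j) j)"
  define B where "B = (\<Sum>j<m. monom (v (n + j)) j)"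
  have coeff_A: "coeff A j = (if j < n then v j else 0)" for j by (auto simp: A_def coeff_sum)
  have coeff_B: "coeff B j = (if j < m then v (n + j) else 0)" for j by (auto simp: B_def coeff_sum)
  have "A * p + B * q = 0"
  proof (rule poly_eqI)
    fix i
    have "A * p + B * q = (\<Sum>j<n. smult (v j) (monom 1 j * p)) + (\<Sum>j<m. smult (v (n + j)) (monom 1 j * q))"
      by (simp add: A_def B_def sum_distrib_right smult_monom flip: mult_smult_left)
    then have "coeff (A * p + B * q) i =
        (\<Sum>j<n. v j * coeff (monom 1 j * p) i) + (\<Sum>j<m. v (n + j) * coeff (monom 1 j * q) i)"
      by (simp only: coeff_add coeff_sum coeff_smult)
    also have "\<dots> = (\<Sum>j<n + m. v j * sylvester m n p q j i)"
      by (simp add: sum_lessThan_add sylvester_def)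
    finally have *: "coeff (A * p + B * q) i = (\<Sum>j<n + m. sylvester m n p q j i * v j)"
      by (simp add: mult.commute)
    show "coeff (A * p + B * q) i = coeff 0 i"
    proof (cases "i < n + m")
      case True
      with * v(3) show ?thesis by simp
    next
      case False
      have "sylvester m n p q j i = 0" if "j < n + m" for j
        using that False p q by (auto simp: sylvester_def coeff_monom_mult intro!: coeff_eq_0)
      with * show ?thesis by simp
    qed
  qed
  then have AB: "A * p = - (B * q)" by (simp add: eq_neg_iff_add_eq_0)
  have "B = 0"
  proof (cases "m = 0")
    case False
    have "degree B \<le> m - 1" by (rule degree_le) (auto simp: coeff_B)
    show ?thesis
    proof (rule poly_eqI_degree[of "{z. poly p z = 0}"])
      fix z assume z: "z \<in> {z. poly p z = 0}"
      then have "poly B z * poly q z = 0" using arg_cong[OF AB, of "\<lambda>h. poly h z"] by simp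
      with z no_root show "poly B z = poly 0 z" by auto
    qed (use False p \<open>degree B \<le> m - 1\<close> in auto)
  qed (simp add: B_def)
  then have "A = 0" using AB p by simp
  show False
  proof (cases "j0 < n")
    case True
    then show False using coeff_A[of j0] v \<open>A = 0\<close> by simp
  next
    case False
    then have "j0 - n < m" "n + (j0 - n) = j0" using v(1) by auto
    then show False using coeff_B[of "j0 - n"] v(2) \<open>B = 0\<close> by simp
  qed
qed

section \<open>Double roots in a pencil of polynomials\<close>

text \<open>
  A ramification argument.  A zero of the Wronskian \<open>W = g' u - g u'\<close> at which \<open>u\<close> is nonzero is a
  double root of the member \<open>g - s u\<close> with \<open>s = g / u\<close> there.  If all zeros of \<open>W\<close> were zeros of
  \<open>u\<close>, then, as \<open>g\<close> is nonzero at them, each would have smaller multiplicity in \<open>W\<close> than in \<open>u\<close>, giving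
  \<open>degree W \<le> degree u\<close>.  But \<open>W\<close> has degree \<open>degree g + degree u - 1\<close>, because \<open>degree u < degree g\<close>
  keeps the leading terms from cancelling.
\<close>

lemma pencil_double_root:
  fixes g u :: "complex poly"
  assumes g: "2 \<le> degree g" and u: "u \<noteq> 0" "degree u < degree g"
    and no_common: "\<And>z. poly g z = 0 \<Longrightarrow> poly u z \<noteq> 0"
  obtains s z where "poly (g - smult s u) z = 0" "poly (pderiv (g - smult s u)) z = 0"
proof (rule ccontr)
  assume "\<not> thesis"
  with that have simple: "poly (pderiv (g - smult s u)) z \<noteq> 0"
    if "poly (g - smult s u) z = 0" for s z using that by blast
  define W where "W = pderiv g * u - g * pderiv u"
  have root_W: "poly u z = 0" if W: "poly W z = 0" for z
  proof (rule ccontr)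
    assume uz: "poly u z \<noteq> 0"
    define s where "s = poly g z / poly u z"
    have "poly (g - smult s u) z = 0" using uz by (simp add: s_def)
    moreover have "poly (pderiv (g - smult s u)) z = 0"
      using W uz by (simp add: W_def s_def pderiv_diff pderiv_smult field_simps)
    ultimately show False using simple by blast
  qed
  define r k where "r = degree g" and "k = degree u"
  have "coeff W (r - 1 + k) = of_nat (r - k) * lead_coeff g * lead_coeff u"
  proof -
    have 1: "coeff (pderiv g * u) (r - 1 + k) = of_nat r * lead_coeff g * lead_coeff u"
      using coeff_mult_degree_sum[of "pderiv g" u] g
      by (simp add: r_def k_def degree_pderiv coeff_pderiv del: of_nat_Suc)
    have 2: "coeff (g * pderiv u) (r - 1 + k) = of_nat k * lead_coeff g * lead_coeff u"
    proof (cases "k = 0")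
      case True
      then have "pderiv u = 0" by (simp add: k_def pderiv_eq_0_iff)
      with True show ?thesis by simp
    next
      case False
      then have "r - 1 + k = degree g + degree (pderiv u)"
        using g by (simp add: r_def k_def degree_pderiv)
      then show ?thesis
        using coeff_mult_degree_sum[of g "pderiv u"] False
        by (simp add: k_def degree_pderiv coeff_pderiv del: of_nat_Suc)
    qed
    have "of_nat (r - k) = (of_nat r - of_nat k :: complex)"
      using u(2) by (simp add: r_def k_def of_nat_diff)
    then show ?thesis unfolding W_def coeff_diff 1 2 by (simp only: left_diff_distrib)
  qed
  moreover have "\<dots> \<noteq> 0" using g u by (auto simp: r_def k_def)
  ultimately have coeff_W: "coeff W (r - 1 + k) \<noteq> 0" by simp
  then have W0: "W \<noteq> 0" by auto
  have order_W: "order z W \<le> order z u" for z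
  proof (cases "poly W z = 0")
    case True
    then have uz: "poly u z = 0" by (rule root_W)
    then have gz: "poly g z \<noteq> 0" using no_common by blast
    obtain V where V: "u = [:- z, 1:] ^ order z u * V" "\<not> [:- z, 1:] dvd V"
      using order_decomp[OF u(1)] by blast
    obtain n where n: "order z u = Suc n"
      using uz u(1) by (metis not0_implies_Suc order_root)
    define K where "K = [:- z, 1:] * (pderiv g * V - g * pderiv V) - smult (of_nat (Suc n)) (g * V)"
    have "pderiv u = [:- z, 1:] ^ Suc n * pderiv V + smult (of_nat (Suc n)) (V * [:- z, 1:] ^ n)"
      by (subst V(1)) (simp only: n lemma_order_pderiv1)
    then have "W = pderiv g * ([:- z, 1:] ^ Suc n * V) -
        g * ([:- z, 1:] ^ Suc n * pderiv V + smult (of_nat (Suc n)) (V * [:- z, 1:] ^ n))"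
      unfolding W_def using V(1) n by simp
    also have "\<dots> = [:- z, 1:] ^ n * K"
      unfolding K_def power_Suc by (simp only: algebra_simps mult_smult_left mult_smult_right smult_diff_right)
    finally have WK: "W = [:- z, 1:] ^ n * K" .
    have "poly V z \<noteq> 0" using V(2) by (simp add: poly_eq_0_iff_dvd)
    then have "poly K z \<noteq> 0" using gz by (simp add: K_def del: of_nat_Suc)
    then have "order z K = 0" by (rule order_0I)
    then have "order z W = n"
      using W0 unfolding WK by (subst order_mult) (auto simp: order_power_n_n)
    then show ?thesis using n by simp
  qed (simp add: order_0I)
  have "proots W \<subseteq># proots u"
    using order_W W0 u(1) by (intro mset_subset_eqI) simp
  then have "degree W \<le> k"
    using size_mset_mono by (force simp: k_def simp flip: size_proots_complex)
  with le_degree[OF coeff_W] g show False by (simp add: r_def)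
qed

section \<open>Functionals supported on few points\<close>

definition root_poly :: "complex set \<Rightarrow> complex poly" where
  "root_poly T = (\<Prod>t\<in>T. [:- t, 1:])"

lemma poly_root_poly: "finite T \<Longrightarrow> poly (root_poly T) z = 0 \<longleftrightarrow> z \<in> T"
  by (auto simp: root_poly_def poly_prod)

lemma degree_root_poly: "degree (root_poly T) = card T"
  unfolding root_poly_def by (subst degree_prod_eq_sum_degree) auto

lemma lead_coeff_root_poly: "lead_coeff (root_poly T) = 1"
  unfolding root_poly_def by (simp add: lead_coeff_prod)

lemma root_poly_simple:
  assumes "finite T" "poly (root_poly T) z = 0"
  shows "poly (pderiv (root_poly T)) z \<noteq> 0"
proof -
  have "z \<in> T" using assms poly_root_poly by blast
  then have eq: "root_poly T = [:- z, 1:] * root_poly (T - {z})"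
    unfolding root_poly_def using assms(1) by (simp add: prod.remove)
  have "poly (pderiv (root_poly T)) z = poly (root_poly (T - {z})) z"
    unfolding eq pderiv_mult by (simp add: pderiv_pCons)
  also have "\<dots> \<noteq> 0" using assms(1) by (simp add: poly_root_poly)
  finally show ?thesis .
qed

text \<open>
  Adding a power of the linear form \<open>x\<^sub>1\<close> to a form adds to its functional \<open>\<Sum>i<r. c i * p (a i)\<close> the
  evaluation at infinity \<open>\<mu> * coeff p d\<close>.  The predicate records what a decomposition of the sum
  into at most \<open>r\<close> powers yields: \<open>T\<close> are its finite points and \<open>b\<close> its weight at infinity, seen only
  on polynomials vanishing on \<open>T\<close>.  If \<open>T\<close> has already \<open>r\<close> points, none is left at infinity.
\<close>

definition short_support ::
    "nat \<Rightarrow> nat \<Rightarrow> (nat \<Rightarrow> complex) \<Rightarrow> (nat \<Rightarrow> complex) \<Rightarrow> complex \<Rightarrow> complex set \<Rightarrow> complex \<Rightarrow> bool" where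
  "short_support r d a c \<mu> T b \<longleftrightarrow> finite T \<and> card T \<le> r \<and> (card T = r \<longrightarrow> b = 0) \<and>
     (\<forall>p. degree p \<le> d \<longrightarrow> (\<forall>t\<in>T. poly p t = 0) \<longrightarrow>
       (\<Sum>i<r. c i * poly p (a i)) + \<mu> * coeff p d = b * coeff p d)"

context
  fixes a c :: "nat \<Rightarrow> complex" and r d :: nat and T :: "complex set" and \<mu> b :: complex
  assumes inj: "inj_on a {..<r}" and c: "\<And>i. i < r \<Longrightarrow> c i \<noteq> 0"
    and d: "2 * r \<le> Suc d" and short: "short_support r d a c \<mu> T b"
begin

lemma short_support_card: "finite T" "card T \<le> r" "card T = r \<Longrightarrow> b = 0"
  using short by (simp_all add: short_support_def)

lemma short_support_functional:
  assumes "degree p \<le> d" "\<And>t. t \<in> T \<Longrightarrow> poly p t = 0"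
  shows "(\<Sum>i<r. c i * poly p (a i)) + \<mu> * coeff p d = b * coeff p d"
  using short assms by (simp add: short_support_def)

text \<open>
  Test the functional on the product of \<open>\<Prod>t\<in>T. (x - t)\<close> with a Lagrange polynomial, whose degree is at
  most \<open>2 r - 1 \<le> d\<close>: only one node survives.
\<close>

lemma node_value:
  assumes i: "i < r"
  defines "l \<equiv> lagrange_basis r a i"
  shows "c i * poly (root_poly T) (a i) * poly l (a i) = (b - \<mu>) * coeff (root_poly T * l) d"
proof -
  have "degree (root_poly T * l) \<le> d"
    using i short_support_card d by (intro order.trans[OF degree_mult_le]) (auto simp: degree_root_poly l_def degree_lagrange_basis)
  moreover have "poly (root_poly T * l) t = 0" if "t \<in> T" for t
    using that short_support_card by (simp add: poly_root_poly)
  ultimately have "(\<Sum>j<r. c j * poly (root_poly T * l) (a j)) + \<mu> * coeff (root_poly T * l) d = b * coeff (root_poly T * l) d"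
    by (rule short_support_functional)
  moreover have "(\<Sum>j<r. c j * poly (root_poly T * l) (a j)) = (\<Sum>j<r. c j * poly (root_poly T) (a j) * poly l (a j))"
    by (simp add: mult.assoc)
  moreover have "\<dots> = c i * poly (root_poly T) (a i) * poly l (a i)"
    unfolding l_def by (rule sum_lagrange_basis[OF i])
  ultimately show ?thesis by (simp add: algebra_simps)
qed

text \<open>
  If the test polynomial has degree below \<open>d\<close>, infinity does not contribute and the surviving node
  has to lie in \<open>T\<close>.
\<close>

lemma nodes_subset:
  assumes "r + card T \<le> d"
  shows "a ` {..<r} \<subseteq> T"
proof safe
  fix i assume i: "i < r"
  have "degree (root_poly T * lagrange_basis r a i) \<le> card T + (r - 1)"
    by (intro order.trans[OF degree_mult_le]) (simp add: degree_root_poly degree_lagrange_basis[OF i])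
  then have "coeff (root_poly T * lagrange_basis r a i) d = 0"
    using assms i by (intro coeff_eq_0) auto
  then have "poly (root_poly T) (a i) = 0"
    using node_value[OF i] c[OF i] poly_lagrange_basis_nonzero[OF inj i] by simp
  then show "a i \<in> T" using short_support_card by (simp add: poly_root_poly)
qed

lemma card_nodes: "card T = r"
proof (rule ccontr)
  assume "card T \<noteq> r"
  then have "card T < r" using short_support_card by simp
  then have "a ` {..<r} \<subseteq> T" using d by (intro nodes_subset) auto
  then have "card (a ` {..<r}) \<le> card T" using short_support_card by (intro card_mono)
  then show False using \<open>card T < r\<close> inj by (simp add: card_image)
qed

text \<open>
  Below the critical degree \<open>T\<close> consists of the nodes themselves, and a monic polynomial of degree \<open>d\<close>
  vanishing on \<open>T\<close> detects \<open>\<mu>\<close>.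
\<close>

lemma infinity_coefficient_eq_0:
  assumes "2 * r \<le> d"
  shows "\<mu> = 0"
proof -
  let ?p = "root_poly T * monom 1 (d - r)"
  have "a ` {..<r} \<subseteq> T" using assms card_nodes by (intro nodes_subset) auto
  then have "poly ?p (a i) = 0" if "i < r" for i
    using that short_support_card poly_root_poly[of T "a i"] by auto
  then have "(\<Sum>i<r. c i * poly ?p (a i)) = 0" by (intro sum.neutral) simp
  moreover have deg: "degree ?p = d"
    using assms lead_coeff_root_poly[of T] card_nodes
    by (subst degree_mult_eq) (auto simp: degree_root_poly degree_monom_eq)
  moreover have "coeff ?p d = 1"
    using lead_coeff_mult[of "root_poly T" "monom 1 (d - r)"] lead_coeff_root_poly[of T] deg
    by (simp add: degree_monom_eq)
  moreover have "poly ?p t = 0" if "t \<in> T" for t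
    using that short_support_card by (simp add: poly_root_poly)
  then have "(\<Sum>i<r. c i * poly ?p (a i)) + \<mu> * coeff ?p d = b * coeff ?p d"
    using deg by (intro short_support_functional) auto
  moreover have "b = 0" using short_support_card(3) card_nodes by simp
  ultimately show ?thesis by simp
qed

lemma node_value_critical:
  assumes "2 * r = Suc d" "i < r"
  shows "c i * poly (root_poly T) (a i) * poly (lagrange_basis r a i) (a i) = - \<mu>"
proof -
  let ?p = "root_poly T * lagrange_basis r a i"
  have lc: "lead_coeff ?p = 1"
    by (simp add: lead_coeff_mult lead_coeff_root_poly lead_coeff_lagrange_basis)
  have "lagrange_basis r a i \<noteq> 0" "root_poly T \<noteq> 0" using lc by auto
  then have "degree ?p = d"
    using assms card_nodes by (simp add: degree_mult_eq degree_root_poly degree_lagrange_basis)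
  with lc have "coeff ?p d = 1" by simp
  then show ?thesis using node_value[OF assms(2)] short_support_card(3) card_nodes by simp
qed

end

text \<open>
  In the critical case \<open>d = 2 r - 1\<close> the set \<open>T\<close> has \<open>r\<close> points, and the values of
  \<open>\<Prod>t\<in>T. (x - t)\<close> at the nodes are forced to be \<open>- \<mu>\<close> times those of a fixed polynomial \<open>u\<close> of degree
  below \<open>r\<close>.  So this product is the member \<open>g - \<mu> u\<close> of a pencil, where \<open>g\<close> has the nodes as roots.
  For \<open>\<mu>\<close> chosen such that \<open>g - \<mu> u\<close> has a double root there can be no such \<open>T\<close>.
\<close>

lemma exists_infinity_coefficient_without_short_support:
  fixes a c :: "nat \<Rightarrow> complex"
  assumes inj: "inj_on a {..<r}" and c: "\<And>i. i < r \<Longrightarrow> c i \<noteq> 0" and r: "2 \<le> r" "2 * r = Suc d"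
  obtains \<mu> where "\<And>T b. \<not> short_support r d a c \<mu> T b"
proof -
  define l where "l = lagrange_basis r a"
  have l_nz: "poly (l i) (a i) \<noteq> 0" if "i < r" for i
    unfolding l_def using poly_lagrange_basis_nonzero[OF inj that] .
  define g where "g = root_poly (a ` {..<r})"
  \<comment> \<open>interpolates the values \<open>1 / (c i * poly (l i) (a i))\<close>, so that \<open>- \<mu> u\<close> solves the equations for the values of \<open>\<Prod>t\<in>T. (x - t)\<close> at the nodes\<close>
  define u where "u = (\<Sum>i<r. smult (1 / (c i * poly (l i) (a i) ^ 2)) (l i))"
  have card: "card (a ` {..<r}) = r" using inj by (simp add: card_image)
  have u_val: "poly u (a j) = 1 / (c j * poly (l j) (a j))" if j: "j < r" for j
  proof -
    have "poly u (a j) = (\<Sum>i<r. 1 / (c i * poly (l i) (a i) ^ 2) * poly (l i) (a j))"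
      by (simp add: u_def poly_sum)
    also have "\<dots> = 1 / (c j * poly (l j) (a j) ^ 2) * poly (l j) (a j)"
      using j by (subst sum.remove[of _ j]) (auto intro!: sum.neutral simp: l_def poly_lagrange_basis_eq_0)
    also have "\<dots> = 1 / (c j * poly (l j) (a j))" using l_nz[OF j] by (simp add: power2_eq_square)
    finally show ?thesis .
  qed
  have u_nz: "poly u (a j) \<noteq> 0" if "j < r" for j using u_val c l_nz that by simp
  have deg_g: "degree g = r" by (simp add: g_def degree_root_poly card)
  have deg_u: "degree u \<le> r - 1" unfolding u_def
    by (intro degree_sum_le order.trans[OF degree_smult_le]) (auto simp: l_def degree_lagrange_basis)
  have "u \<noteq> 0" using u_nz[of 0] r by auto
  moreover have "poly u z \<noteq> 0" if "poly g z = 0" for z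
    using that u_nz by (auto simp: g_def poly_root_poly)
  ultimately obtain \<mu> z where z: "poly (g - smult \<mu> u) z = 0" "poly (pderiv (g - smult \<mu> u)) z = 0"
    using r deg_g deg_u by (elim pencil_double_root[of g u, rotated -1]) auto
  show thesis
  proof (rule that[of \<mu>])
    fix T b
    show "\<not> short_support r d a c \<mu> T b"
    proof
      assume short: "short_support r d a c \<mu> T b"
      then have T: "finite T" by (simp add: short_support_def)
      have d: "2 * r \<le> Suc d" using r by simp
      note facts = inj c d short
      have cardT: "card T = r" by (rule card_nodes[OF facts])
      have "root_poly T = g - smult \<mu> u"
      proof (rule poly_eqI_degree_lead_coeff[of _ r _ "a ` {..<r}"])
        have "coeff (root_poly T) r = 1" using lead_coeff_root_poly[of T] by (simp add: degree_root_poly cardT)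
        moreover have "coeff g r = 1" using lead_coeff_root_poly[of "a ` {..<r}"] deg_g by (simp add: g_def)
        moreover have "coeff u r = 0" using deg_u r by (intro coeff_eq_0) auto
        ultimately show "coeff (root_poly T) r = coeff (g - smult \<mu> u) r" by simp
        show "degree (g - smult \<mu> u) \<le> r"
          using deg_g deg_u by (intro degree_diff_le order.trans[OF degree_smult_le]) auto
      next
        fix x assume "x \<in> a ` {..<r}"
        then obtain i where i: "i < r" "x = a i" by auto
        have "c i * poly (root_poly T) (a i) * poly (l i) (a i) = - \<mu>"
          unfolding l_def by (rule node_value_critical[OF facts r(2) i(1)])
        then have "poly (root_poly T) (a i) = - \<mu> * poly u (a i)"
          using c[OF i(1)] l_nz[OF i(1)] by (simp add: u_val[OF i(1)] field_simps)
        moreover have "poly g (a i) = 0" using i by (simp add: g_def poly_root_poly)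
        ultimately show "poly (root_poly T) x = poly (g - smult \<mu> u) x" using i by simp
      qed (use card cardT in \<open>auto simp: degree_root_poly\<close>)
      then show False using z root_poly_simple[OF T] by metis
    qed
  qed
qed

no_notation vec_index (infixl "$" 100)
unbundle no fps_syntax

section \<open>Rank after adding a power of a new linear form\<close>

text \<open>
  Restricting an identity between sums of powers to the line \<open>A + z B\<close> and comparing the coefficients
  of \<open>z^k\<close> gives the moments in the linear coordinates defined by \<open>A\<close> and \<open>B\<close>.  This replaces a
  linear change of variables.
\<close>

lemma power_sum_moments:
  fixes v w :: "nat \<Rightarrow> complex^2"
  assumes eq: "\<And>x. (\<Sum>i\<in>I. s i * linear_form (v i) x ^ d) = (\<Sum>j\<in>J. t j * linear_form (w j) x ^ d)"
    and k: "k \<le> d"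
  shows "(\<Sum>i\<in>I. s i * linear_form (v i) A ^ (d - k) * linear_form (v i) B ^ k) =
    (\<Sum>j\<in>J. t j * linear_form (w j) A ^ (d - k) * linear_form (w j) B ^ k)"
proof -
  define \<Phi> where "\<Phi> K c u = (\<Sum>i\<in>K. smult (c i) ([:linear_form (u i) A, linear_form (u i) B:] ^ d))"
    for K :: "nat set" and c and u :: "nat \<Rightarrow> complex^2"
  have poly_\<Phi>: "poly (\<Phi> K c u) z = (\<Sum>i\<in>K. c i * linear_form (u i) (A + z *s B) ^ d)" for K c u z
    by (simp add: \<Phi>_def poly_sum linear_form_def algebra_simps)
  have coeff_\<Phi>: "coeff (\<Phi> K c u) k = of_nat (d choose k) *
      (\<Sum>i\<in>K. c i * linear_form (u i) A ^ (d - k) * linear_form (u i) B ^ k)" for K c u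
    by (simp add: \<Phi>_def coeff_sum coeff_linear_poly_power[OF k] sum_distrib_left mult_ac)
  have "poly (\<Phi> I s v) = poly (\<Phi> J t w)" using eq by (auto simp: poly_\<Phi>)
  then have "\<Phi> I s v = \<Phi> J t w" by (simp add: poly_eq_poly_eq_iff)
  then have "coeff (\<Phi> I s v) k = coeff (\<Phi> J t w) k" by simp
  then show ?thesis using k by (simp add: coeff_\<Phi>)
qed

text \<open>
  The homogenisation of degree \<open>d\<close> of \<open>p\<close> at the point \<open>(\<alpha>, \<beta>)\<close> of the projective line, where
  \<open>\<alpha> = 0\<close> is the point at infinity.
\<close>

lemma homogenized_value:
  fixes \<alpha> \<beta> :: "'a :: field"
  assumes "degree p \<le> d"
  shows "(\<Sum>k\<le>d. coeff p k * (\<alpha> ^ (d - k) * \<beta> ^ k)) =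
    (if \<alpha> = 0 then \<beta> ^ d * coeff p d else \<alpha> ^ d * poly p (\<beta> / \<alpha>))"
proof (cases "\<alpha> = 0")
  case True
  then have "(\<Sum>k\<le>d. coeff p k * (\<alpha> ^ (d - k) * \<beta> ^ k)) = (\<Sum>k\<le>d. if k = d then coeff p d * \<beta> ^ d else 0)"
    by (intro sum.cong) (auto simp: power_0_left)
  with True show ?thesis by simp
next
  case False
  have "\<alpha> ^ d * poly p (\<beta> / \<alpha>) = (\<Sum>k\<le>d. \<alpha> ^ d * (coeff p k * (\<beta> / \<alpha>) ^ k))"
    unfolding poly_altdef sum_distrib_left
    using assms by (intro sum.mono_neutral_left) (auto simp: coeff_eq_0)
  also have "\<dots> = (\<Sum>k\<le>d. coeff p k * (\<alpha> ^ (d - k) * \<beta> ^ k))"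
    using False by (intro sum.cong) (auto simp: power_diff field_simps)
  finally show ?thesis using False by simp
qed

lemma linear_form_smult: "linear_form (k *s a) x = k * linear_form a x"
  by (simp add: linear_form_def algebra_simps)

lemma linear_form_scaled_power:
  assumes "0 < d"
  obtains b where "\<And>x. c * linear_form a x ^ d = linear_form b x ^ d"
proof -
  have "\<exists>z. z ^ d = c"
  proof (cases "c = 0")
    case False
    then have "exp (Ln c / of_nat d) ^ d = c"
      using assms by (simp flip: exp_of_nat_mult)
    then show ?thesis by blast
  qed (use assms in auto)
  then obtain z where "z ^ d = c" by blast
  then show thesis
    by (intro that[of "z *s a"]) (simp add: linear_form_smult power_mult_distrib)
qed

text \<open>
  Coordinates are chosen such that \<open>L\<close> becomes the point at infinity: the coordinates of a linear form
  \<open>(v\<^sub>1, v\<^sub>2)\<close> are \<open>\<alpha> = L\<^sub>1 v\<^sub>2 - L\<^sub>2 v\<^sub>1\<close>, which vanishes exactly on the multiples of \<open>L\<close>, and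
  \<open>\<beta> = m v\<^sub>1 + n v\<^sub>2\<close>, normalised to be \<open>1\<close> at \<open>L\<close>.
\<close>

lemma short_decomposition_functional:
  fixes a c :: "nat \<Rightarrow> complex" and L :: "complex^2" and w :: "nat \<Rightarrow> complex^2"
  assumes mn: "L $ 1 * m + L $ 2 * n = 1"
    and off: "\<And>i. i < r \<Longrightarrow> L $ 1 * a i - L $ 2 \<noteq> 0"
    and eq: "\<And>x. (\<Sum>i<r. c i * linear_form (vector [1, a i]) x ^ d) + \<mu> * linear_form L x ^ d =
      (\<Sum>j<s. linear_form (w j) x ^ d)"
    and s: "s \<le> r"
  shows "\<exists>T b. short_support r d (\<lambda>i. (m + n * a i) / (L $ 1 * a i - L $ 2))
    (\<lambda>i. c i * (L $ 1 * a i - L $ 2) ^ d) \<mu> T b"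
proof -
  define A B where "A = (vector [- (L $ 2), L $ 1] :: complex^2)" and "B = (vector [m, n] :: complex^2)"
  define \<alpha> \<beta> where "\<alpha> j = linear_form (w j) A" and "\<beta> j = linear_form (w j) B" for j
  define fin where "fin = {j. j < s \<and> \<alpha> j \<noteq> 0}"
  define T where "T = (\<lambda>j. \<beta> j / \<alpha> j) ` fin"
  define b where "b = (\<Sum>j\<in>{..<s} - fin. \<beta> j ^ d)"
  have fin: "finite fin" "fin \<subseteq> {..<s}" by (auto simp: fin_def)
  have card_fin: "card T \<le> card fin" "card fin \<le> s"
    using card_image_le[OF fin(1)] card_mono[OF _ fin(2)] by (auto simp: T_def)
  \<comment> \<open>the power of \<open>L\<close> is treated as one more summand\<close>
  define v where "v i = (if i < r then vector [1, a i] else L)" for i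
  define c' where "c' i = (if i < r then c i else \<mu>)" for i
  have eq': "(\<Sum>i<Suc r. c' i * linear_form (v i) x ^ d) = (\<Sum>j<s. 1 * linear_form (w j) x ^ d)" for x
    using eq[of x] by (simp add: v_def c'_def)
  have "(\<Sum>i<r. c i * (L $ 1 * a i - L $ 2) ^ d * poly p ((m + n * a i) / (L $ 1 * a i - L $ 2))) +
        \<mu> * coeff p d = b * coeff p d"
    if p: "degree p \<le> d" "\<And>t. t \<in> T \<Longrightarrow> poly p t = 0" for p
  proof -
    define h where "h x = (\<Sum>k\<le>d. coeff p k * (linear_form x A ^ (d - k) * linear_form x B ^ k))" for x
    have h: "h x = (if linear_form x A = 0 then linear_form x B ^ d * coeff p d
        else linear_form x A ^ d * poly p (linear_form x B / linear_form x A))" for x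
      unfolding h_def by (rule homogenized_value[OF p(1)])
    have "(\<Sum>i<Suc r. c' i * h (v i)) =
        (\<Sum>k\<le>d. coeff p k * (\<Sum>i<Suc r. c' i * linear_form (v i) A ^ (d - k) * linear_form (v i) B ^ k))"
      unfolding h_def sum_distrib_left by (subst sum.swap) (simp only: mult_ac)
    also have "\<dots> = (\<Sum>k\<le>d. coeff p k * (\<Sum>j<s. 1 * linear_form (w j) A ^ (d - k) * linear_form (w j) B ^ k))"
      using power_sum_moments[of c' v d "{..<Suc r}" "\<lambda>_. 1" w "{..<s}", OF eq'] by (intro sum.cong) auto
    also have "\<dots> = (\<Sum>j<s. h (w j))"
      unfolding h_def sum_distrib_left by (subst sum.swap) (simp only: mult_ac mult_1)
    also have "\<dots> = (\<Sum>j\<in>{..<s} - fin. h (w j)) + (\<Sum>j\<in>fin. h (w j))"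
      by (rule sum.subset_diff[OF fin(2)]) simp
    also have "(\<Sum>j\<in>fin. h (w j)) = 0"
      using p(2) by (intro sum.neutral) (auto simp: h T_def fin_def \<alpha>_def \<beta>_def)
    also have "(\<Sum>j\<in>{..<s} - fin. h (w j)) = b * coeff p d"
      unfolding b_def sum_distrib_right by (intro sum.cong) (auto simp: h fin_def \<alpha>_def \<beta>_def)
    finally have "(\<Sum>i<r. c i * h (vector [1, a i])) + \<mu> * h L = b * coeff p d"
      by (simp add: v_def c'_def)
    moreover have "linear_form L A = 0" "linear_form L B = 1"
      using mn by (simp_all add: A_def B_def linear_form_def)
    then have "h L = coeff p d" by (simp add: h)
    moreover have "linear_form (vector [1, a i]) A = L $ 1 * a i - L $ 2"
      "linear_form (vector [1, a i]) B = m + n * a i" for i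
      by (simp_all add: A_def B_def linear_form_def mult_ac)
    then have "h (vector [1, a i]) =
        (L $ 1 * a i - L $ 2) ^ d * poly p ((m + n * a i) / (L $ 1 * a i - L $ 2))" if "i < r" for i
      using off[OF that] by (simp add: h)
    ultimately show ?thesis by (simp add: mult.assoc)
  qed
  moreover have "b = 0" if "card T = r"
  proof -
    have "card fin = card {..<s}" using that card_fin s by simp
    then have "fin = {..<s}" using fin by (intro card_subset_eq) auto
    then show ?thesis by (simp add: b_def)
  qed
  moreover have "finite T" "card T \<le> r" using fin card_fin s by (auto simp: T_def)
  ultimately have "short_support r d (\<lambda>i. (m + n * a i) / (L $ 1 * a i - L $ 2))
    (\<lambda>i. c i * (L $ 1 * a i - L $ 2) ^ d) \<mu> T b"
    unfolding short_support_def by blast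
  then show ?thesis by blast
qed

lemma waring_rank_eq_SucI:
  assumes "\<exists>a. F = (\<lambda>x. \<Sum>i<Suc r. linear_form (a i) x ^ d)"
    and "\<And>s w. s \<le> r \<Longrightarrow> F = (\<lambda>x. \<Sum>j<s. linear_form (w j) x ^ d) \<Longrightarrow> False"
  shows "waring_rank d F = r + 1"
  unfolding waring_rank_def
proof (rule Least_equality)
  fix y :: nat assume "\<exists>w. F = (\<lambda>x. \<Sum>j<y. linear_form (w j) x ^ d)"
  with assms(2) show "r + 1 \<le> y" by (metis not_less_eq_eq Suc_eq_plus1)
qed (use assms(1) in simp)

text \<open>
  The power of \<open>L\<close> raises the rank by one below the critical degree since \<open>d + 1\<close> pairwise independent
  linear forms have independent \<open>d\<close>-th powers.  In the critical degree a suitable coefficient of the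
  power is supplied by a double root in a pencil.
\<close>

theorem waring_rank_add_power:
  fixes a c :: "nat \<Rightarrow> complex" and L :: "complex^2"
  assumes r: "2 \<le> r" "2 * r \<le> Suc d" and inj: "inj_on a {..<r}" and c: "\<And>i. i < r \<Longrightarrow> c i \<noteq> 0"
    and L: "L \<noteq> 0" and off: "\<And>i. i < r \<Longrightarrow> L $ 1 * a i \<noteq> L $ 2"
  defines "F \<equiv> \<lambda>x. \<Sum>i<r. c i * linear_form (vector [1, a i]) x ^ d"
  shows "\<exists>\<mu>. waring_rank d (\<lambda>x. F x + \<mu> * linear_form L x ^ d) = r + 1"
    and "2 * r \<le> d \<Longrightarrow> \<mu> \<noteq> 0 \<Longrightarrow> waring_rank d (\<lambda>x. F x + \<mu> * linear_form L x ^ d) = r + 1"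
proof -
  have "L $ 1 \<noteq> 0 \<or> L $ 2 \<noteq> 0" using L by (auto simp: Finite_Cartesian_Product.vec_eq_iff forall_2)
  then obtain m n where mn: "L $ 1 * m + L $ 2 * n = 1"
  proof
    assume "L $ 1 \<noteq> 0"
    then show thesis by (intro that[of "1 / L $ 1" 0]) auto
  next
    assume "L $ 2 \<noteq> 0"
    then show thesis by (intro that[of 0 "1 / L $ 2"]) auto
  qed
  define c' where "c' i = c i * (L $ 1 * a i - L $ 2) ^ d" for i
  define a' where "a' i = (m + n * a i) / (L $ 1 * a i - L $ 2)" for i
  have off': "L $ 1 * a i - L $ 2 \<noteq> 0" if "i < r" for i using off[OF that] by simp
  have c': "c' i \<noteq> 0" if "i < r" for i using off'[OF that] c[OF that] by (simp add: c'_def)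
  have inj': "inj_on a' {..<r}"
  proof (rule inj_onI)
    fix i j assume ij: "i \<in> {..<r}" "j \<in> {..<r}" "a' i = a' j"
    have "(m + n * a i) * (L $ 1 * a j - L $ 2) - (m + n * a j) * (L $ 1 * a i - L $ 2) =
        (L $ 1 * m + L $ 2 * n) * (a j - a i)"
      by (simp add: algebra_simps)
    moreover have "(m + n * a i) * (L $ 1 * a j - L $ 2) = (m + n * a j) * (L $ 1 * a i - L $ 2)"
      using ij off'[of i] off'[of j] by (simp add: a'_def frac_eq_eq)
    ultimately have "a i = a j" using mn by simp
    with ij inj show "i = j" by (auto dest: inj_onD)
  qed
  have upper: "\<exists>w. (\<lambda>x. F x + \<mu> * linear_form L x ^ d) = (\<lambda>x. \<Sum>i<Suc r. linear_form (w i) x ^ d)" for \<mu>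
  proof -
    define v where "v i = (if i < r then vector [1, a i] else L)" for i
    define k where "k i = (if i < r then c i else \<mu>)" for i
    have "\<exists>b. \<forall>x. k i * linear_form (v i) x ^ d = linear_form b x ^ d" for i
      using linear_form_scaled_power[of d "k i" "v i"] r by auto
    then obtain w where w: "\<And>i x. k i * linear_form (v i) x ^ d = linear_form (w i) x ^ d" by metis
    have "F x + \<mu> * linear_form L x ^ d = (\<Sum>i<Suc r. linear_form (w i) x ^ d)" for x
      by (simp add: F_def v_def k_def flip: w)
    then show ?thesis by blast
  qed
  have short: "\<exists>T b. short_support r d a' c' \<mu> T b"
    if "s \<le> r" "(\<lambda>x. F x + \<mu> * linear_form L x ^ d) = (\<lambda>x. \<Sum>j<s. linear_form (w j) x ^ d)" for s w \<mu>
  proof -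
    have eq: "(\<Sum>i<r. c i * linear_form (vector [1, a i]) x ^ d) + \<mu> * linear_form L x ^ d =
        (\<Sum>j<s. linear_form (w j) x ^ d)" for x
      using fun_cong[OF that(2), of x] unfolding F_def .
    show ?thesis
      unfolding a'_def c'_def by (rule short_decomposition_functional[OF mn off' eq that(1)])
  qed
  show noncritical: "waring_rank d (\<lambda>x. F x + \<mu> * linear_form L x ^ d) = r + 1"
    if "2 * r \<le> d" "\<mu> \<noteq> 0" for \<mu>
  proof (rule waring_rank_eq_SucI[OF upper])
    fix s w assume "s \<le> r" "(\<lambda>x. F x + \<mu> * linear_form L x ^ d) = (\<lambda>x. \<Sum>j<s. linear_form (w j) x ^ d)"
    from short[OF this] obtain T b where T: "short_support r d a' c' \<mu> T b" by blast
    from infinity_coefficient_eq_0[OF inj' c' r(2) T that(1)] that(2) show False by simp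
  qed
  show "\<exists>\<mu>. waring_rank d (\<lambda>x. F x + \<mu> * linear_form L x ^ d) = r + 1"
  proof (cases "2 * r \<le> d")
    case True
    from noncritical[OF this one_neq_zero] show ?thesis by blast
  next
    case False
    then have "2 * r = Suc d" using r by simp
    from exists_infinity_coefficient_without_short_support[where a = a' and c = c', OF inj' c' r(1) this]
    obtain \<mu> where \<mu>: "\<And>T b. \<not> short_support r d a' c' \<mu> T b" by blast
    have "waring_rank d (\<lambda>x. F x + \<mu> * linear_form L x ^ d) = r + 1"
      by (rule waring_rank_eq_SucI[OF upper]) (use short \<mu> in blast)
    then show ?thesis by blast
  qed
qed

section \<open>Binary forms and their moments\<close>

lemma binary_form_eq_iff:
  "binary_form d c = binary_form d c' \<longleftrightarrow> (\<forall>k\<le>d. c k = c' k)"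
proof
  assume eq: "binary_form d c = binary_form d c'"
  define \<Phi> where "\<Phi> c = (\<Sum>k\<le>d. monom (c k) k)" for c :: "nat \<Rightarrow> complex"
  have "poly (\<Phi> c) t = binary_form d c (vector [1, t])" for c t
    by (simp add: \<Phi>_def binary_form_def poly_sum poly_monom)
  then have "poly (\<Phi> c) = poly (\<Phi> c')" using eq by auto
  then have "\<Phi> c = \<Phi> c'" by (simp add: poly_eq_poly_eq_iff)
  moreover have "coeff (\<Phi> c) k = c k" if "k \<le> d" for c k
    using that by (simp add: \<Phi>_def coeff_sum)
  ultimately show "\<forall>k\<le>d. c k = c' k" by metis
qed (auto simp: binary_form_def)

lemma sum_linear_form_powers:
  fixes v :: "'a \<Rightarrow> complex^2"
  shows
  "(\<lambda>x. \<Sum>i\<in>I. s i * linear_form (v i) x ^ d) =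
     binary_form d (\<lambda>k. of_nat (d choose k) * (\<Sum>i\<in>I. s i * (v i $ 1) ^ (d - k) * (v i $ 2) ^ k))"
proof
  fix x :: "complex^2"
  have "linear_form a x ^ d = (\<Sum>k\<le>d. of_nat (d choose k) * (a $ 1) ^ (d - k) * (a $ 2) ^ k * (x $ 1) ^ (d - k) * (x $ 2) ^ k)" for a :: "complex^2"
    unfolding linear_form_def
    by (subst add.commute, subst binomial_ring) (simp add: power_mult_distrib mult_ac)
  then have "(\<Sum>i\<in>I. s i * linear_form (v i) x ^ d) =
      (\<Sum>i\<in>I. \<Sum>k\<le>d. s i * (of_nat (d choose k) * (v i $ 1) ^ (d - k) * (v i $ 2) ^ k * (x $ 1) ^ (d - k) * (x $ 2) ^ k))"
    by (simp only: sum_distrib_left)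
  also have "\<dots> = binary_form d (\<lambda>k. of_nat (d choose k) * (\<Sum>i\<in>I. s i * (v i $ 1) ^ (d - k) * (v i $ 2) ^ k)) x"
    unfolding binary_form_def sum_distrib_left sum_distrib_right
    by (subst sum.swap) (simp only: mult_ac)
  finally show "(\<Sum>i\<in>I. s i * linear_form (v i) x ^ d) =
     binary_form d (\<lambda>k. of_nat (d choose k) * (\<Sum>i\<in>I. s i * (v i $ 1) ^ (d - k) * (v i $ 2) ^ k)) x" .
qed

lemma proj_class_self: "F \<in> proj_class F"
  by (auto simp: proj_class_def intro!: exI[of _ 1])

lemma proj_class_eqD:
  assumes "proj_class F = proj_class G"
  obtains k where "k \<noteq> 0" "F = (\<lambda>x. k * G x)"
  using assms proj_class_self[of F] by (auto simp: proj_class_def)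

text \<open>
  Dividing by the binomial coefficients turns the coefficients of \<open>(x\<^sub>0 + a x\<^sub>1)^d\<close> into the powers of
  \<open>a\<close>.
\<close>

definition moments :: "nat \<Rightarrow> (nat \<Rightarrow> complex) \<Rightarrow> nat \<Rightarrow> complex" where
  "moments d c k = c k / of_nat (d choose k)"

lemma binary_form_power_sum_moments:
  fixes v :: "'a \<Rightarrow> complex^2"
  assumes "binary_form d c = (\<lambda>x. \<Sum>i\<in>I. s i * linear_form (v i) x ^ d)" "k \<le> d"
  shows "moments d c k = (\<Sum>i\<in>I. s i * (v i $ 1) ^ (d - k) * (v i $ 2) ^ k)"
  using assms unfolding sum_linear_form_powers binary_form_eq_iff by (simp add: moments_def)

section \<open>The genericity polynomial\<close>

text \<open>
  Up to the factor \<open>d\<close> this is the determinant of the rows \<open>\<nabla>F(1, x)\<close> and \<open>(1, x)\<close>, written in the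
  moments of the form \<open>F\<close>.
\<close>

definition eigen_poly :: "nat \<Rightarrow> (nat \<Rightarrow> complex) \<Rightarrow> complex poly" where
  "eigen_poly d f =
     (\<Sum>k<d. smult (of_nat ((d - 1) choose k)) (monom (f k) (Suc k) - monom (f (Suc k)) k))"

lemma degree_eigen_poly_le: "degree (eigen_poly d f) \<le> d"
  unfolding eigen_poly_def
  by (intro degree_sum_le order.trans[OF degree_smult_le] degree_diff_le
      order.trans[OF degree_monom_le]) auto

lemma poly_eigen_poly:
  assumes d: "0 < d" and f: "\<And>k. k \<le> d \<Longrightarrow> f k = (\<Sum>i\<in>I. c i * a i ^ k)"
  shows "poly (eigen_poly d f) z = (\<Sum>i\<in>I. c i * (1 + a i * z) ^ (d - 1) * (z - a i))"
proof -
  have binom: "(\<Sum>k<d. of_nat ((d - 1) choose k) * (a i * z) ^ k) = (1 + a i * z) ^ (d - 1)" for i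
  proof -
    have "{..<d} = {..d - 1}" using d by auto
    then show ?thesis by (subst add.commute) (simp add: binomial_ring)
  qed
  have "poly (eigen_poly d f) z =
      (\<Sum>k<d. of_nat ((d - 1) choose k) * (f k * z ^ Suc k - f (Suc k) * z ^ k))"
    by (simp add: eigen_poly_def poly_sum poly_monom)
  also have "\<dots> = (\<Sum>k<d. \<Sum>i\<in>I. c i * (z - a i) * (of_nat ((d - 1) choose k) * (a i * z) ^ k))"
  proof (rule sum.cong)
    fix k assume "k \<in> {..<d}"
    then have "f k = (\<Sum>i\<in>I. c i * a i ^ k)" "f (Suc k) = (\<Sum>i\<in>I. c i * a i ^ Suc k)"
      by (simp_all only: f lessThan_iff Suc_leI less_imp_le)
    then have "f k * z ^ Suc k - f (Suc k) * z ^ k =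
        (\<Sum>i\<in>I. c i * a i ^ k * z ^ Suc k - c i * a i ^ Suc k * z ^ k)"
      by (simp only: sum_distrib_right sum_subtractf)
    also have "\<dots> = (\<Sum>i\<in>I. c i * (z - a i) * (a i * z) ^ k)"
      by (rule sum.cong) (simp_all add: power_mult_distrib algebra_simps)
    finally show "of_nat ((d - 1) choose k) * (f k * z ^ Suc k - f (Suc k) * z ^ k) =
        (\<Sum>i\<in>I. c i * (z - a i) * (of_nat ((d - 1) choose k) * (a i * z) ^ k))"
      by (simp add: sum_distrib_left mult_ac)
  qed simp
  also have "\<dots> = (\<Sum>i\<in>I. c i * (z - a i) * (\<Sum>k<d. of_nat ((d - 1) choose k) * (a i * z) ^ k))"
    by (subst sum.swap) (simp add: sum_distrib_left)
  finally show ?thesis unfolding binom by (simp only: mult_ac)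
qed

definition eigen_resultant :: "nat \<Rightarrow> nat \<Rightarrow> (nat \<Rightarrow> complex) \<Rightarrow> complex" where
  "eigen_resultant r d f = formal_resultant r (r - 1 + d) (apolar_poly r f)
     (pderiv (apolar_poly r f) * eigen_poly d f)"

text \<open>
  Its nonvanishing says that the apolar polynomial \<open>g\<close> has full degree \<open>r\<close> and has no root in common
  with the product of its derivative and the eigenvector polynomial.  So the roots of \<open>g\<close> are simple,
  and none of them gives an eigenvector.
\<close>

definition genericity :: "nat \<Rightarrow> nat \<Rightarrow> (nat \<Rightarrow> complex) \<Rightarrow> complex" where
  "genericity r d c = coeff (apolar_poly r (moments d c)) r * eigen_resultant r d (moments d c)"

lemma degree_pderiv_eigen_poly_le:
  "degree (pderiv (apolar_poly r f) * eigen_poly d f) \<le> r - 1 + d"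
proof -
  have "degree (pderiv (apolar_poly r f)) \<le> r - 1"
    unfolding degree_pderiv by (rule diff_le_mono[OF degree_apolar_poly_le])
  then show ?thesis
    by (rule order.trans[OF degree_mult_le add_mono[OF _ degree_eigen_poly_le]])
qed

lemma homogeneous_poly_moments: "k \<le> d \<Longrightarrow> homogeneous_poly d 1 (\<lambda>c. moments d c k)"
  using homogeneous_poly_cmult[OF homogeneous_poly.coord, of k d "1 / of_nat (d choose k)"]
  by (simp add: moments_def)

lemma homogeneous_poly_apolar_poly:
  assumes "2 * r \<le> Suc d"
  shows "homogeneous_poly d r (\<lambda>c. coeff (apolar_poly r (moments d c)) j)"
proof (cases "j \<le> r")
  case True
  have "homogeneous_poly d (\<Sum>i<r. 1) (\<lambda>c. Determinant.det
      (mat r r (\<lambda>(i, k). moments d c (i + (if k < j then k else Suc k)))))"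
    by (rule homogeneous_poly_det, rule homogeneous_poly_moments) (use assms in auto)
  then have "homogeneous_poly d r (\<lambda>c. apolar_coeff r (moments d c) j)"
    unfolding apolar_coeff_def by (intro homogeneous_poly_cmult) simp
  with True show ?thesis by (simp add: coeff_apolar_poly)
qed (simp add: coeff_apolar_poly homogeneous_poly_zero)

lemma homogeneous_poly_eigen_poly:
  "homogeneous_poly d 1 (\<lambda>c. coeff (eigen_poly d (moments d c)) j)"
proof -
  have "homogeneous_poly d 1 (\<lambda>c. \<Sum>k<d. of_nat ((d - 1) choose k) *
      ((if Suc k = j then moments d c k else 0) + - 1 * (if k = j then moments d c (Suc k) else 0)))"
  proof (rule homogeneous_poly_sum)
    fix k assume "k \<in> {..<d}"
    then have "homogeneous_poly d 1 (\<lambda>c. if Suc k = j then moments d c k else 0)"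
      "homogeneous_poly d 1 (\<lambda>c. if k = j then moments d c (Suc k) else 0)"
      by (cases "Suc k = j"; cases "k = j"; simp add: homogeneous_poly_zero homogeneous_poly_moments[simplified])+
    then show "homogeneous_poly d 1 (\<lambda>c. of_nat ((d - 1) choose k) *
      ((if Suc k = j then moments d c k else 0) + - 1 * (if k = j then moments d c (Suc k) else 0)))"
      by (rule homogeneous_poly_cmult[OF homogeneous_poly.add[OF _ homogeneous_poly_cmult]])
  qed
  then show ?thesis by (simp add: eigen_poly_def coeff_sum)
qed

lemma homogeneous_poly_genericity:
  assumes d: "2 * r \<le> Suc d" and r: "0 < r"
  obtains m where "homogeneous_poly d m (genericity r d)" "0 < m"
proof -
  define g where "g c = apolar_poly r (moments d c)" for c
  define h where "h c = pderiv (g c) * eigen_poly d (moments d c)" for c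
  have g: "homogeneous_poly d r (\<lambda>c. coeff (g c) j)" for j
    unfolding g_def by (rule homogeneous_poly_apolar_poly[OF d])
  have h: "homogeneous_poly d (r + 1) (\<lambda>c. coeff (h c) j)" for j
    unfolding h_def coeff_mult coeff_pderiv
    by (intro homogeneous_poly_sum homogeneous_poly.mult homogeneous_poly_cmult g homogeneous_poly_eigen_poly)
  define N where "N = r - 1 + d"
  \<comment> \<open>the rows of the Sylvester matrix have degree \<open>r\<close> (from \<open>g\<close>) or \<open>r + 1\<close> (from \<open>h\<close>)\<close>
  have "homogeneous_poly d (if i < N then r else r + 1) (\<lambda>c. sylvester r N (g c) (h c) i j)" for i j
  proof (cases "i < N")
    case True
    then show ?thesis by (cases "j < i") (simp_all add: sylvester_def coeff_monom_mult g homogeneous_poly_zero)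
  next
    case False
    then show ?thesis using h
      by (cases "j < i - N") (simp_all add: sylvester_def coeff_monom_mult homogeneous_poly_zero)
  qed
  then have "homogeneous_poly d (\<Sum>i<N + r. if i < N then r else r + 1) (\<lambda>c. formal_resultant r N (g c) (h c))"
    unfolding formal_resultant_def by (rule homogeneous_poly_det)
  from homogeneous_poly.mult[OF g[of r] this] show thesis
    unfolding g_def h_def N_def eigen_resultant_def[symmetric] genericity_def[symmetric] by (rule that) (use r in simp)
qed

section \<open>Generic points of the secant variety\<close>

lemma openin_hypersurface_compl:
  "homogeneous_poly d m P \<Longrightarrow> openin (zariski d) (hypersurface_compl d P)"
  unfolding zariski_def by (rule topology_generated_by_Basis) blast

lemma homogeneous_poly_binary_form_eq_0:
  assumes "homogeneous_poly d m P" "0 < m" "binary_form d c = (\<lambda>_. 0)"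
  shows "P c = 0"
proof -
  have "binary_form d c = binary_form d (\<lambda>_. 0)" using assms(3) by (auto simp: binary_form_def)
  then have "P c = P (\<lambda>k. 0 * c k)"
    by (intro homogeneous_poly_cong[OF assms(1)]) (auto simp: binary_form_eq_iff)
  also have "\<dots> = 0" using assms(2) by (subst homogeneous_poly_scale[OF assms(1)]) simp
  finally show ?thesis .
qed

text \<open>
  A point of the closure at which \<open>P\<close> does not vanish has the open set \<open>P \<noteq> 0\<close> as a neighbourhood,
  which therefore meets the union of the spans.
\<close>

lemma secant_variety_vanishing:
  assumes sec: "proj_class (binary_form d c) \<in> secant_variety r d"
    and P: "homogeneous_poly d m P" "0 < m"
    and vanish: "\<And>c' s v. binary_form d c' = (\<lambda>x. \<Sum>i<r. s i * linear_form (v i) x ^ d) \<Longrightarrow> P c' = 0"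
  shows "P c = 0"
proof (rule ccontr)
  assume Pc: "P c \<noteq> 0"
  then have "binary_form d c \<noteq> (\<lambda>_. 0)" using homogeneous_poly_binary_form_eq_0[OF P] by blast
  then have "proj_class (binary_form d c) \<in> hypersurface_compl d P"
    using Pc by (auto simp: hypersurface_compl_def)
  then obtain y where "y \<in> hypersurface_compl d P" and y: "\<exists>t G. y = proj_class (\<lambda>x. \<Sum>i<r. t i * G i x) \<and>
      (\<forall>i<r. proj_class (G i) \<in> rational_normal_curve d)"
    using sec openin_hypersurface_compl[OF P(1)] unfolding secant_variety_def in_closure_of by blast
  then obtain c' where c': "y = proj_class (binary_form d c')" "P c' \<noteq> 0"
    by (auto simp: hypersurface_compl_def)
  from y obtain t G where G: "y = proj_class (\<lambda>x. \<Sum>i<r. t i * G i x)"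
    "\<And>i. i < r \<Longrightarrow> proj_class (G i) \<in> rational_normal_curve d" by blast
  have "\<exists>k v. \<forall>x. G i x = k * linear_form v x ^ d" if i: "i < r" for i
  proof -
    from G(2)[OF i] obtain v where "proj_class (G i) = proj_class (\<lambda>x. linear_form v x ^ d)"
      by (auto simp: rational_normal_curve_def)
    then obtain k where "G i = (\<lambda>x. k * linear_form v x ^ d)" by (rule proj_class_eqD)
    then show ?thesis by auto
  qed
  then obtain k v where kv: "\<And>i x. i < r \<Longrightarrow> G i x = k i * linear_form (v i) x ^ d" by metis
  from c'(1) G(1) obtain l where l: "binary_form d c' = (\<lambda>x. l * (\<Sum>i<r. t i * G i x))"
    using proj_class_eqD by metis
  have "binary_form d c' = (\<lambda>x. \<Sum>i<r. (l * t i * k i) * linear_form (v i) x ^ d)"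
    unfolding l by (simp add: kv sum_distrib_left mult_ac)
  then have "P c' = 0" by (rule vanish)
  with c'(2) show False by simp
qed

lemma secant_variety_apolar:
  assumes sec: "proj_class (binary_form d c) \<in> secant_variety r d"
    and d: "2 * r \<le> Suc d" and m: "m + r \<le> d"
  shows "pairing (moments d c) (monom 1 m * apolar_poly r (moments d c)) = 0"
proof (rule secant_variety_vanishing[OF sec, where m = "r + 1"])
  show "homogeneous_poly d (r + 1)
      (\<lambda>c. pairing (moments d c) (monom 1 m * apolar_poly r (moments d c)))"
    unfolding pairing_monom_mult[OF degree_apolar_poly_le]
    by (intro homogeneous_poly_sum homogeneous_poly.mult homogeneous_poly_apolar_poly[OF d]
        homogeneous_poly_moments) (use m in auto)
next
  fix c' s v assume "binary_form d c' = (\<lambda>x. \<Sum>i<r. s i * linear_form (v i) x ^ d)"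
  from binary_form_power_sum_moments[OF this]
  show "pairing (moments d c') (monom 1 m * apolar_poly r (moments d c')) = 0"
    by (rule pairing_apolar_power_sum[OF _ m d])
qed simp

lemma binary_form_of_point_moments:
  assumes "\<And>k. k \<le> d \<Longrightarrow> moments d c k = (\<Sum>i<r. s i * a i ^ k)"
  shows "binary_form d c = (\<lambda>x. \<Sum>i<r. s i * linear_form (vector [1, a i]) x ^ d)"
proof -
  have "c k = of_nat (d choose k) * (\<Sum>i<r. s i * a i ^ k)" if "k \<le> d" for k
    using assms[OF that] that by (simp add: moments_def field_simps)
  then show ?thesis
    unfolding sum_linear_form_powers binary_form_eq_iff by simp
qed

text \<open>
  All points of the Zariski closure satisfy the apolarity relations, since these are polynomial.  With
  the simple roots provided by the genericity polynomial, Sylvester's criterion yields an actual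
  decomposition, and its summands are not eigenvectors.
\<close>

lemma generic_decomposition:
  assumes sec: "proj_class (binary_form d c) \<in> secant_variety r d"
    and r: "0 < r" "2 * r \<le> Suc d" and gen: "genericity r d c \<noteq> 0"
  shows "\<exists>s a. inj_on a {..<r} \<and> (\<forall>i<r. s i \<noteq> 0) \<and>
    binary_form d c = (\<lambda>x. \<Sum>i<r. s i * linear_form (vector [1, a i]) x ^ d) \<and>
    (\<forall>i<r. (\<Sum>j<r. s j * (1 + a j * a i) ^ (d - 1) * (a i - a j)) \<noteq> 0)"
proof -
  define f where "f = moments d c"
  define g where "g = apolar_poly r f"
  have lc: "coeff g r \<noteq> 0" and res: "eigen_resultant r d f \<noteq> 0"
    using gen by (auto simp: genericity_def f_def g_def)
  have no_common: "poly (pderiv g) z \<noteq> 0" "poly (eigen_poly d f) z \<noteq> 0" if "poly g z = 0" for z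
    using formal_resultant_common_root[of g r "pderiv g * eigen_poly d f" "r - 1 + d" z]
      degree_apolar_poly_le[of r f] degree_pderiv_eigen_poly_le[of r f d]
      that r res by (auto simp: eigen_resultant_def g_def)
  have sqf: "rsquarefree g" unfolding rsquarefree_roots using no_common by blast
  have rel: "pairing f (monom 1 m * g) = 0" if "m + r \<le> d" for m
    unfolding f_def g_def by (rule secant_variety_apolar[OF sec r(2) that])
  show ?thesis
  proof (rule apolar_representation[OF r(2), of f, folded g_def, OF lc rel sqf])
    fix s a
    assume a: "inj_on a {..<r}" "\<And>k. k \<le> d \<Longrightarrow> f k = (\<Sum>i<r. s i * a i ^ k)"
      "\<And>i. i < r \<Longrightarrow> s i \<noteq> 0" "\<And>i. i < r \<Longrightarrow> poly g (a i) = 0"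
    show ?thesis
    proof (rule exI[of _ s], rule exI[of _ a], intro conjI allI impI)
      show "binary_form d c = (\<lambda>x. \<Sum>i<r. s i * linear_form (vector [1, a i]) x ^ d)"
        using a(2) unfolding f_def by (rule binary_form_of_point_moments)
      fix i assume i: "i < r"
      have "poly (eigen_poly d f) (a i) = (\<Sum>j<r. s j * (1 + a j * a i) ^ (d - 1) * (a i - a j))"
        using r a(2) by (intro poly_eigen_poly) auto
      with no_common(2)[OF a(4)[OF i]]
      show "(\<Sum>j<r. s j * (1 + a j * a i) ^ (d - 1) * (a i - a j)) \<noteq> 0" by simp
    qed (use a in auto)
  qed
qed

lemma genericity_nonzero:
  assumes r: "0 < r" "2 * r \<le> Suc d" and a: "inj_on a {..<r}" and s: "\<And>i. i < r \<Longrightarrow> s i \<noteq> 0"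
    and F: "binary_form d c = (\<lambda>x. \<Sum>i<r. s i * linear_form (vector [1, a i]) x ^ d)"
    and eig: "\<And>i. i < r \<Longrightarrow> (\<Sum>j<r. s j * (1 + a j * a i) ^ (d - 1) * (a i - a j)) \<noteq> 0"
  shows "genericity r d c \<noteq> 0"
proof -
  define f where "f = moments d c"
  have f: "f k = (\<Sum>i<r. s i * a i ^ k)" if "k \<le> d" for k
    using binary_form_power_sum_moments[OF F that] by (simp add: f_def)
  note g = apolar_poly_of_points[OF r(2) a f s]
  have "degree (apolar_poly r f) = r"
    using le_degree[OF g(1)] degree_apolar_poly_le[of r f] by simp
  moreover have "{z. poly (apolar_poly r f) z = 0} = a ` {..<r}" using g(2) by auto
  then have "card {z. poly (apolar_poly r f) z = 0} = r" using a by (simp add: card_image)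
  moreover have "poly (pderiv (apolar_poly r f) * eigen_poly d f) z \<noteq> 0"
    if z: "poly (apolar_poly r f) z = 0" for z
  proof -
    from z g(2) obtain i where i: "i < r" "z = a i" by auto
    have "poly (eigen_poly d f) z = (\<Sum>j<r. s j * (1 + a j * z) ^ (d - 1) * (z - a j))"
      using r f by (intro poly_eigen_poly) auto
    then have "poly (eigen_poly d f) z \<noteq> 0" using eig[OF i(1)] i(2) by simp
    moreover have "poly (pderiv (apolar_poly r f)) z \<noteq> 0"
      using g(3) z unfolding rsquarefree_roots by blast
    ultimately show ?thesis by simp
  qed
  moreover have "apolar_poly r f \<noteq> 0" using g(1) by auto
  ultimately have "eigen_resultant r d f \<noteq> 0"
    unfolding eigen_resultant_def
    by (intro formal_resultant_nonzero degree_pderiv_eigen_poly_le) auto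
  with g(1) show ?thesis by (simp add: genericity_def f_def)
qed

text \<open>
  Weights for which no summand is an eigenvector.  For the nodes \<open>0, 1, 2, \<dots>\<close> the factors
  \<open>1 + i j\<close> are positive, so with weights \<open>K^j\<close> each condition excludes only the roots of a nonzero
  polynomial in \<open>K\<close>.
\<close>

lemma generic_weights:
  assumes "2 \<le> r"
  shows "\<exists>K :: complex. K \<noteq> 0 \<and>
    (\<forall>i<r. (\<Sum>j<r. K ^ j * (1 + of_nat j * of_nat i) ^ n * (of_nat i - of_nat j)) \<noteq> 0)"
proof -
  define w :: "nat \<Rightarrow> nat \<Rightarrow> complex"
    where "w i j = (1 + of_nat j * of_nat i) ^ n * (of_nat i - of_nat j)" for i j
  define q where "q i = (\<Sum>j<r. monom (w i j) j)" for i
  have "q i \<noteq> 0" for i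
  proof -
    \<comment> \<open>any index below \<open>r\<close> and different from \<open>i\<close> will do; this needs \<open>2 \<le> r\<close>\<close>
    define j where "j = (if i = 0 then 1 else 0 :: nat)"
    have "j < r" "i \<noteq> j" using assms by (auto simp: j_def)
    have "(1 + of_nat j * of_nat i :: complex) = of_nat (Suc (j * i))" by simp
    then have "w i j \<noteq> 0" using \<open>i \<noteq> j\<close> unfolding w_def by (simp del: of_nat_Suc)
    moreover have "coeff (q i) j = w i j" using \<open>j < r\<close> by (simp add: q_def coeff_sum)
    ultimately show ?thesis by auto
  qed
  then have "monom 1 1 * (\<Prod>i<r. q i) \<noteq> 0" by (simp add: monom_eq_0_iff)
  then have "finite {z. poly (monom 1 1 * (\<Prod>i<r. q i)) z = 0}" by (rule poly_roots_finite)
  then obtain K where K: "poly (monom 1 1 * (\<Prod>i<r. q i)) K \<noteq> 0"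
    using infinite_UNIV_char_0[where 'a = complex] by (metis (mono_tags, lifting) UNIV_I finite_subset mem_Collect_eq subsetI)
  show ?thesis
  proof (intro exI[of _ K] conjI allI impI)
    show "K \<noteq> 0" using K by (auto simp: poly_monom)
    fix i assume "i < r"
    then have "poly (q i) K \<noteq> 0" using K by (auto simp: poly_prod)
    then show "(\<Sum>j<r. K ^ j * (1 + of_nat j * of_nat i) ^ n * (of_nat i - of_nat j)) \<noteq> 0"
      by (simp add: q_def poly_sum poly_monom w_def mult_ac)
  qed
qed

lemma power_sum_in_secant_variety:
  assumes v: "\<And>i. i < r \<Longrightarrow> v i \<noteq> 0" and F: "binary_form d c = (\<lambda>x. \<Sum>i<r. s i * linear_form (v i) x ^ d)"
    and nz: "binary_form d c \<noteq> (\<lambda>_. 0)"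
  shows "proj_class (binary_form d c) \<in> secant_variety r d"
proof -
  have "proj_class (binary_form d c) \<in> topspace (zariski d)"
    using nz by (auto simp: topspace_zariski proj_space_def binary_forms_def)
  moreover have "\<exists>t G. proj_class (binary_form d c) = proj_class (\<lambda>x. \<Sum>i<r. t i * G i x) \<and>
      (\<forall>i<r. proj_class (G i) \<in> rational_normal_curve d) \<and> (\<lambda>x. \<Sum>i<r. t i * G i x) \<noteq> (\<lambda>_. 0)"
    using v nz unfolding F
    by (intro exI[of _ s] exI[of _ "\<lambda>i x. linear_form (v i) x ^ d"]) (auto simp: rational_normal_curve_def)
  ultimately show ?thesis unfolding secant_variety_def in_closure_of by blast
qed

section \<open>Eigenvectors among the summands\<close>

lemma gradient_power_sum:
  fixes x :: "complex^2"
  shows "gradient (\<lambda>x. \<Sum>j\<in>I. s j * linear_form (vector [1, a j]) x ^ d) x =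
    vector [of_nat d * (\<Sum>j\<in>I. s j * (x $ 1 + a j * x $ 2) ^ (d - 1)),
            of_nat d * (\<Sum>j\<in>I. s j * a j * (x $ 1 + a j * x $ 2) ^ (d - 1))]"
proof -
  have "((\<lambda>t. \<Sum>j\<in>I. s j * (t + a j * x $ 2) ^ d) has_field_derivative
      of_nat d * (\<Sum>j\<in>I. s j * (x $ 1 + a j * x $ 2) ^ (d - 1))) (at (x $ 1))"
    by (auto intro!: derivative_eq_intros simp: sum_distrib_left mult_ac)
  moreover have "((\<lambda>t. \<Sum>j\<in>I. s j * (x $ 1 + a j * t) ^ d) has_field_derivative
      of_nat d * (\<Sum>j\<in>I. s j * a j * (x $ 1 + a j * x $ 2) ^ (d - 1))) (at (x $ 2))"
    by (auto intro!: derivative_eq_intros simp: sum_distrib_left mult_ac)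
  ultimately show ?thesis
    by (simp add: gradient_def linear_form_def DERIV_imp_deriv)
qed

text \<open>
  If \<open>L\<close> were proportional to \<open>(1, a i)\<close>, then the determinant defining the eigenscheme, taken at a
  representative of the point \<open>[L]\<close>, would be a nonzero multiple of the value of the eigenvector polynomial at \<open>a i\<close>.
\<close>

lemma summand_not_eigenvector:
  fixes L :: "complex^2"
  assumes d: "0 < d"
    and eig: "\<And>i. i < r \<Longrightarrow> (\<Sum>j<r. s j * (1 + a j * a i) ^ (d - 1) * (a i - a j)) \<noteq> 0"
    and L: "proj_class (linear_form L) \<in> Eig (\<lambda>x. \<Sum>j<r. s j * linear_form (vector [1, a j]) x ^ d)"
  shows "L \<noteq> 0" and "i < r \<Longrightarrow> L $ 1 * a i \<noteq> L $ 2"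
proof -
  define F where "F = (\<lambda>x. \<Sum>j<r. s j * linear_form (vector [1, a j]) x ^ d)"
  from L obtain w where w: "w \<noteq> 0" "Determinants.det (vector [gradient F w, w] :: complex^2^2) = 0"
    "proj_class (linear_form L) = proj_class (linear_form w)"
    by (auto simp: Eig_def F_def)
  from w(3) obtain k where k: "k \<noteq> 0" "linear_form L = (\<lambda>x. k * linear_form w x)"
    by (rule proj_class_eqD)
  have L_eq: "L $ 1 = k * w $ 1" "L $ 2 = k * w $ 2"
    using fun_cong[OF k(2), of "vector [1, 0]"] fun_cong[OF k(2), of "vector [0, 1]"]
    by (simp_all add: linear_form_def)
  have w_nz: "w $ 1 \<noteq> 0 \<or> w $ 2 \<noteq> 0"
    using w(1) by (auto simp: Finite_Cartesian_Product.vec_eq_iff forall_2)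
  then show "L \<noteq> 0" using L_eq k(1) by auto
  show "L $ 1 * a i \<noteq> L $ 2" if i: "i < r"
  proof
    assume "L $ 1 * a i = L $ 2"
    then have w2: "w $ 2 = w $ 1 * a i" using L_eq k(1) by (simp add: mult.assoc)
    with w_nz have w1: "w $ 1 \<noteq> 0" by auto
    have "Determinants.det (vector [gradient F w, w] :: complex^2^2) =
        of_nat d * (\<Sum>j<r. s j * (w $ 1 + a j * w $ 2) ^ (d - 1)) * w $ 2 -
        of_nat d * (\<Sum>j<r. s j * a j * (w $ 1 + a j * w $ 2) ^ (d - 1)) * w $ 1"
      by (simp add: F_def gradient_power_sum det_2)
    also have "\<dots> = of_nat d * w $ 1 *
        (\<Sum>j<r. s j * (w $ 1 + a j * w $ 2) ^ (d - 1) * (a i - a j))"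
      unfolding w2 sum_distrib_left sum_distrib_right sum_subtractf[symmetric]
      by (rule sum.cong) (simp_all add: algebra_simps)
    also have "(\<Sum>j<r. s j * (w $ 1 + a j * w $ 2) ^ (d - 1) * (a i - a j)) =
        (w $ 1) ^ (d - 1) * (\<Sum>j<r. s j * (1 + a j * a i) ^ (d - 1) * (a i - a j))"
    proof -
      have "w $ 1 + a j * w $ 2 = w $ 1 * (1 + a j * a i)" for j by (simp add: w2 algebra_simps)
      then show ?thesis by (simp add: sum_distrib_left power_mult_distrib mult_ac)
    qed
    finally show False using w(2) w1 d eig[OF i] by simp
  qed
qed

section \<open>Waring rank and eigenvectors of a generic form\<close>

theorem corollary5p3:
  fixes d r :: nat
  assumes "2 \<le> r" and "real r \<le> (real d + 1) / 2"
  shows "\<exists>U. openin (subtopology (zariski d) (secant_variety r d)) U \<and> U \<noteq> {} \<and>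
    (\<forall>F \<in> binary_forms d. proj_class F \<in> U \<longrightarrow>
      (\<forall>L\<^sub>0 :: complex^2. proj_class (linear_form L\<^sub>0) \<in> Eig F \<longrightarrow>
        (\<exists>\<mu> :: complex. waring_rank d (\<lambda>x. F x + \<mu> * linear_form L\<^sub>0 x ^ d) = r + 1) \<and>
        (real r < (real d + 1) / 2 \<longrightarrow>
          (\<forall>\<mu> :: complex. \<mu> \<noteq> 0 \<longrightarrow>
            waring_rank d (\<lambda>x. F x + \<mu> * linear_form L\<^sub>0 x ^ d) = r + 1))))"
proof -
  have r: "2 \<le> r" "2 * r \<le> Suc d" using assms by (auto simp: field_simps)
  then have r0: "0 < r" by simp
  obtain M where M: "homogeneous_poly d M (genericity r d)" "0 < M"
    using homogeneous_poly_genericity[OF r(2) r0] .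
  define U where "U = hypersurface_compl d (genericity r d) \<inter> secant_variety r d"
  have "openin (subtopology (zariski d) (secant_variety r d)) U"
    unfolding openin_subtopology U_def using openin_hypersurface_compl[OF M(1)] by blast
  moreover have "U \<noteq> {}"
  proof -
    obtain K :: complex where K: "K \<noteq> 0"
      "\<forall>i<r. (\<Sum>j<r. K ^ j * (1 + of_nat j * of_nat i) ^ (d - 1) * (of_nat i - of_nat j)) \<noteq> 0"
      using generic_weights[OF r(1), of "d - 1"] by (elim exE conjE) (rule that)
    obtain c where c: "binary_form d c = (\<lambda>x. \<Sum>i<r. K ^ i * linear_form (vector [1, of_nat i]) x ^ d)"
      by (rule that[OF sum_linear_form_powers[symmetric]])
    have gen: "genericity r d c \<noteq> 0"
      by (rule genericity_nonzero[OF r0 r(2) _ _ c K(2)[rule_format]]) (use K(1) in \<open>auto simp: inj_on_def\<close>)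
    have nz: "binary_form d c \<noteq> (\<lambda>_. 0)"
      using homogeneous_poly_binary_form_eq_0[OF M] gen by blast
    have "(vector [1, of_nat i] :: complex^2) \<noteq> 0" for i
      by (simp add: Finite_Cartesian_Product.vec_eq_iff forall_2)
    then have "proj_class (binary_form d c) \<in> secant_variety r d"
      using c nz by (intro power_sum_in_secant_variety) auto
    then have "proj_class (binary_form d c) \<in> U"
      using gen nz by (auto simp: U_def hypersurface_compl_def)
    then show ?thesis by blast
  qed
  moreover have "(\<exists>\<mu>. waring_rank d (\<lambda>x. F x + \<mu> * linear_form L x ^ d) = r + 1) \<and>
      (real r < (real d + 1) / 2 \<longrightarrow>
        (\<forall>\<mu>. \<mu> \<noteq> 0 \<longrightarrow> waring_rank d (\<lambda>x. F x + \<mu> * linear_form L x ^ d) = r + 1))"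
    if F: "proj_class F \<in> U" and L: "proj_class (linear_form L) \<in> Eig F" for F L
  proof -
    from F obtain c where c: "proj_class F = proj_class (binary_form d c)" "genericity r d c \<noteq> 0"
      and sec: "proj_class F \<in> secant_variety r d"
      by (auto simp: U_def hypersurface_compl_def)
    from c(1) obtain k where k: "k \<noteq> 0" "F = (\<lambda>x. k * binary_form d c x)" by (rule proj_class_eqD)
    have F_eq: "F = binary_form d (\<lambda>i. k * c i)"
      unfolding k(2) by (simp add: binary_form_def sum_distrib_left mult.assoc)
    have gen: "genericity r d (\<lambda>i. k * c i) \<noteq> 0"
      using c(2) k(1) by (subst homogeneous_poly_scale[OF M(1)]) simp
    obtain s a where a: "inj_on a {..<r}" "\<forall>i<r. s i \<noteq> 0"
      "F = (\<lambda>x. \<Sum>i<r. s i * linear_form (vector [1, a i]) x ^ d)"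
      "\<forall>i<r. (\<Sum>j<r. s j * (1 + a j * a i) ^ (d - 1) * (a i - a j)) \<noteq> 0"
      using generic_decomposition[OF sec[unfolded F_eq] r0 r(2) gen, folded F_eq]
      by (elim exE conjE) (rule that)
    have d: "0 < d" using r by simp
    note off = summand_not_eigenvector[OF d a(4)[rule_format] L[unfolded a(3)]]
    note rank = waring_rank_add_power[OF r a(1) a(2)[rule_format] off]
    show ?thesis
      unfolding a(3) using rank by (auto simp: field_simps)
  qed
  ultimately show ?thesis by blast
qed

end
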